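(* Let $d,s\in\mathbb{N}$. There is a constant $c=c(d,s)\in\mathbb{N}$, depending only on $d$ and $s$ (and not on the field or on $n$), such that the following holds for every prime finite field $\mathbb{F}$ and every $n\in\mathbb{N}$. Let $f\in\mathcal{P}_d(\mathbb{F}^n)$ and suppose that $\left|\mathbb{E}_{x\in\mathbb{F}^n}[e(f(x))]\right|\ge |\mathbb{F}|^{-s}$. Then there exist $g_1,\ldots,g_c\in\mathcal{P}_{d-1}(\mathbb{F}^n)$ and a function $\Gamma:\mathbb{F}^c\to\mathbb{F}$ such that $f(x)=\Gamma(g_1(x),\ldots,g_c(x))$ for all $x\in\mathbb{F}^n$. Moreover, each $g_i$ is a derivative of $f$: $g_i=D_{h_i}f$ for some $h_i\in\mathbb{F}^n$.
   Context: $\mathbb{F}$ is a prime finite field $\mathbb{F}_p$, and $|\cdot|:\mathbb{F}\to\{0,\ldots,p-1\}$ is the natural map. $\mathcal{P}_d(\mathbb{F}^n)$ is the family of polynomials $f:\mathbb{F}^n\to\mathbb{F}$ of total degree at most $d$. The additive character is $e:\mathbb{F}\to\mathbb{C}$, $e(a)=\exp(2\pi i |a|/p)$. For $h\in\mathbb{F}^n$, the derivative of $f$ in direction $h$ is $D_hf(x)=f(x+h)-f(x)$. *)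

theory Defs
  imports Complex_Main "HOL-Library.FuncSet" "HOL-Computational_Algebra.Primes"
begin

text \<open>
  Both the prime \<open>p\<close> and the dimension \<open>n\<close> are quantified inside the scope of the constant
  \<open>c\<close>, so they cannot be types. An element of \<open>F\<^sub>p\<close> is represented by its canonical
  representative in \<open>{0, \<dots>, p - 1}\<close>, with arithmetic modulo \<open>p\<close>; the natural map from
  \<open>F\<^sub>p\<close> to \<open>{0, \<dots>, p - 1}\<close> is then the identity. Vectors, and functions on \<open>F\<^sub>p\<^sup>n\<close>, are
  extensional, so that equality in HOL is equality of the mathematical objects.
\<close>

definition Fp :: "nat \<Rightarrow> int set" where
  "Fp p = {0..<int p}"

definition vecs :: "nat \<Rightarrow> nat \<Rightarrow> (nat \<Rightarrow> int) set" where
  "vecs p n = {..<n} \<rightarrow>\<^sub>E Fp p"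

definition vadd :: "nat \<Rightarrow> nat \<Rightarrow> (nat \<Rightarrow> int) \<Rightarrow> (nat \<Rightarrow> int) \<Rightarrow> (nat \<Rightarrow> int)" where
  "vadd p n x y = (\<lambda>i\<in>{..<n}. (x i + y i) mod int p)"

text \<open>
  Exponent vectors of the monomials in \<open>n\<close> variables of total degree at most \<open>d\<close>. The bound is
  an integer so that degree at most \<open>-1\<close> leaves no monomials, i.e. only the zero polynomial.
\<close>

definition exponents :: "nat \<Rightarrow> int \<Rightarrow> (nat \<Rightarrow> nat) set" where
  "exponents n d = {\<alpha> \<in> {..<n} \<rightarrow>\<^sub>E UNIV. int (\<Sum>i<n. \<alpha> i) \<le> d}"

lemma finite_exponents: "finite (exponents n d)"
proof (rule finite_subset)
  show "exponents n d \<subseteq> {..<n} \<rightarrow>\<^sub>E {..nat d}"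
  proof
    fix \<alpha> assume \<alpha>: "\<alpha> \<in> exponents n d"
    have "\<alpha> i \<le> nat d" if "i < n" for i
    proof -
      have "\<alpha> i \<le> (\<Sum>i<n. \<alpha> i)"
        using that by (intro member_le_sum) auto
      then show ?thesis
        using \<alpha> unfolding exponents_def mem_Collect_eq by linarith
    qed
    then show "\<alpha> \<in> {..<n} \<rightarrow>\<^sub>E {..nat d}"
      using \<alpha> by (auto simp: exponents_def PiE_iff)
  qed
qed (simp add: finite_PiE)

definition polys :: "nat \<Rightarrow> nat \<Rightarrow> int \<Rightarrow> ((nat \<Rightarrow> int) \<Rightarrow> int) set" where
  "polys p n d = {f \<in> vecs p n \<rightarrow>\<^sub>E Fp p.
     \<exists>a \<in> exponents n d \<rightarrow> Fp p. \<forall>x \<in> vecs p n.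
       f x = (\<Sum>\<alpha>\<in>exponents n d. a \<alpha> * (\<Prod>i<n. x i ^ \<alpha> i)) mod int p}"

definition derivative ::
  "nat \<Rightarrow> nat \<Rightarrow> (nat \<Rightarrow> int) \<Rightarrow> ((nat \<Rightarrow> int) \<Rightarrow> int) \<Rightarrow> (nat \<Rightarrow> int) \<Rightarrow> int" where
  "derivative p n h f = (\<lambda>x\<in>vecs p n. (f (vadd p n x h) - f x) mod int p)"

definition add_char :: "nat \<Rightarrow> int \<Rightarrow> complex" where
  "add_char p a = exp (2 * complex_of_real pi * \<i> * of_int a / of_nat p)"

definition expectation :: "nat \<Rightarrow> nat \<Rightarrow> ((nat \<Rightarrow> int) \<Rightarrow> complex) \<Rightarrow> complex" where
  "expectation p n F = (\<Sum>x\<in>vecs p n. F x) / of_nat (card (vecs p n))"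

end

theory Submission
  imports Defs "HOL-Number_Theory.Cong" "HOL-Library.Function_Algebras" "HOL-Library.Multiset"
begin

text \<open>
  Write \<open>\<mu> = E e(f)\<close>. Since \<open>\<mu> e(- f(x)) = E\<^sub>h e(D\<^sub>h f(x))\<close>, averaging over a random grid of
  bounded dimension recovers \<open>f(x)\<close> from boundedly many derivatives of \<open>f\<close> for all but a small
  proportion of the points \<open>x\<close>: distinct points of the grid are pairwise independent, and the values
  of a bounded degree polynomial on the grid \<open>{0, \<dots>, p - 1}\<^sup>r\<close> are determined by those on
  \<open>{0, \<dots>, d}\<^sup>r\<close>.

  To reach every \<open>x\<close>, note that \<open>f(x)\<close> is determined by the values of \<open>f\<close> at the other vertices
  \<open>x + \<Sum>\<^bsub>i \<in> S\<^esub> y\<^sub>i\<close> of any \<open>d + 1\<close>-dimensional cube based at \<open>x\<close>, and almost all cubes have only good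
  vertices. So \<open>f(x) = f(x')\<close> as soon as the distributions of the derivatives on the vertices of a
  random cube at \<open>x\<close> and at \<open>x'\<close> overlap. If all linear combinations of these values are
  unbiased, both distributions are nearly uniform. Otherwise the Gowers-Cauchy-Schwarz inequality yields
  a biased polynomial of degree less than \<open>d\<close> on a space of larger dimension, and by induction on the
  degree one of the values is determined by others, which are of lower degree or sit on lower
  dimensional faces, and by boundedly many derivatives of \<open>f\<close> at the base point. This trade
  terminates after a bounded number of steps.
\<close>

section \<open>Means over finite sets\<close>

text \<open>Sampling leaves an exceptional set of points, and the derivatives at a vertex of a cube
  are not functions of the derivatives at its base point. The proof therefore never computes f(x)
  from a cube: it only needs one pair of cubes, based at x and x', with good vertices and equal data
  at corresponding vertices. This is weak enough to follow from a counting argument with densities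
  3/4, and it survives replacing one datum by others that determine it. A bias found at one base
  point can be used at all of them, since the Gowers-Cauchy-Schwarz inequality averages over the
  base point as well. The directions used for sampling do not enter the final list; they only
  prescribe which data must agree. The final list consists of what the replacements ask for at the
  base point itself, where iterated derivatives reduce to single derivatives of f. Uniformity in p
  comes from measuring bias in powers of p: counting values costs a factor
  \<open>p ^ card I\<close>, each sampling direction gains a factor p, and all exponents depend only
  on d and s.\<close>

definition mean :: "'a set \<Rightarrow> ('a \<Rightarrow> 'b::real_normed_field) \<Rightarrow> 'b" where
  "mean X F = (\<Sum>x\<in>X. F x) / of_nat (card X)"

lemma mean_cong: "(\<And>x. x \<in> X \<Longrightarrow> F x = G x) \<Longrightarrow> mean X F = mean X G"
  by (simp add: mean_def cong: sum.cong)

lemma mean_const: "finite X \<Longrightarrow> X \<noteq> {} \<Longrightarrow> mean X (\<lambda>_. c) = c"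
  by (simp add: mean_def)

lemma mean_singleton: "mean {x} F = F x"
  by (simp add: mean_def)

lemma mean_add: "mean X (\<lambda>x. F x + G x) = mean X F + mean X G"
  by (simp add: mean_def sum.distrib add_divide_distrib)

lemma mean_mult_left: "mean X (\<lambda>x. c * F x) = c * mean X F"
  by (simp add: mean_def sum_distrib_left)

lemma mean_mult_right: "mean X (\<lambda>x. F x * c) = mean X F * c"
  by (simp add: mean_def sum_distrib_right)

lemma mean_cnj: "mean X (\<lambda>x. cnj (F x)) = cnj (mean X F)"
  by (simp add: mean_def)

lemma mean_swap: "mean X (\<lambda>x. mean Y (F x)) = mean Y (\<lambda>y. mean X (\<lambda>x. F x y))"
proof -
  have "(\<Sum>x\<in>X. \<Sum>y\<in>Y. F x y) = (\<Sum>y\<in>Y. \<Sum>x\<in>X. F x y)"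
    by (rule sum.swap)
  then show ?thesis
    unfolding mean_def sum_divide_distrib[symmetric] by (simp add: mult.commute)
qed

lemma mean_reindex: "bij_betw \<phi> X Y \<Longrightarrow> mean X (\<lambda>x. F (\<phi> x)) = mean Y F"
  unfolding mean_def by (simp add: sum.reindex_bij_betw bij_betw_same_card)

lemma mean_of_real: "mean X (\<lambda>x. of_real (F x)) = of_real (mean X F)"
  by (simp add: mean_def)

lemma mean_Re: "mean X (\<lambda>x. Re (F x)) = Re (mean X F)"
  by (simp add: mean_def)

lemma norm_mean_le: "norm (mean X F) \<le> mean X (\<lambda>x. norm (F x))"
  unfolding mean_def norm_divide norm_of_nat
  by (intro divide_right_mono norm_sum) simp

lemma mean_mono: "(\<And>x. x \<in> X \<Longrightarrow> F x \<le> G x) \<Longrightarrow> mean X F \<le> (mean X G :: real)"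
  unfolding mean_def by (intro divide_right_mono sum_mono) auto

lemma mean_nonneg: "(\<And>x. x \<in> X \<Longrightarrow> 0 \<le> F x) \<Longrightarrow> 0 \<le> (mean X F :: real)"
  unfolding mean_def by (simp add: sum_nonneg)

lemma mean_le_attained:
  assumes "finite X" "X \<noteq> {}"
  shows "\<exists>x\<in>X. F x \<le> (mean X F :: real)"
proof (rule ccontr)
  assume "\<not> ?thesis"
  then have "(\<Sum>x\<in>X. mean X F) < (\<Sum>x\<in>X. F x)"
    using assms by (intro sum_strict_mono) (auto simp: not_le)
  then show False
    using assms by (simp add: mean_def)
qed

lemma mean_ge_attained:
  assumes "finite X" "X \<noteq> {}"
  shows "\<exists>x\<in>X. (mean X F :: real) \<le> F x"
proof -
  obtain x where "x \<in> X" "- F x \<le> mean X (\<lambda>x. - F x)"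
    using mean_le_attained[OF assms, of "\<lambda>x. - F x"] by blast
  moreover have "mean X (\<lambda>x. - F x) = - mean X F"
    by (simp add: mean_def sum_negf)
  ultimately show ?thesis
    by auto
qed

lemma norm_mean_attained:
  assumes "finite X" "X \<noteq> {}"
  shows "\<exists>x\<in>X. norm (mean X F) \<le> norm (F x)"
  using mean_ge_attained[OF assms, of "\<lambda>x. norm (F x)"] norm_mean_le[of X F] order_trans by blast

lemma mean_square_le:
  assumes "finite X" "X \<noteq> {}"
  shows "(mean X F)\<^sup>2 \<le> (mean X (\<lambda>x. (F x)\<^sup>2) :: real)"
proof -
  define m where "m = mean X F"
  have "0 \<le> mean X (\<lambda>x. (F x - m)\<^sup>2)"
    by (intro mean_nonneg) simp
  also have "\<dots> = mean X (\<lambda>x. (F x)\<^sup>2 + ((- 2 * m) * F x + m\<^sup>2))"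
    by (intro mean_cong) (simp add: power2_eq_square algebra_simps)
  also have "\<dots> = mean X (\<lambda>x. (F x)\<^sup>2) + ((- 2 * m) * m + m\<^sup>2)"
    unfolding mean_add mean_mult_left mean_const[OF assms] m_def ..
  finally show ?thesis
    by (simp add: m_def power2_eq_square)
qed

text \<open>Jensen's inequality by repeated squaring. Powers of two are the exponents that
  successive applications of Cauchy-Schwarz produce.\<close>

lemma mean_power_le:
  fixes F :: "'a \<Rightarrow> real"
  assumes "finite X" "X \<noteq> {}"
  shows "\<lbrakk>\<And>x. x \<in> X \<Longrightarrow> 0 \<le> F x\<rbrakk> \<Longrightarrow> mean X F ^ 2 ^ k \<le> mean X (\<lambda>x. F x ^ 2 ^ k)"
proof (induction k arbitrary: F)
  case (Suc k)
  have "mean X F ^ 2 ^ Suc k = ((mean X F)\<^sup>2) ^ 2 ^ k"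
    by (simp add: power_mult)
  also have "\<dots> \<le> mean X (\<lambda>x. (F x)\<^sup>2) ^ 2 ^ k"
    by (intro power_mono mean_square_le assms) simp
  also have "\<dots> \<le> mean X (\<lambda>x. ((F x)\<^sup>2) ^ 2 ^ k)"
    by (intro Suc.IH) simp
  finally show ?case
    by (simp add: power_mult)
qed simp

lemma norm_mean_square:
  "of_real ((norm (mean X F))\<^sup>2) = mean X (\<lambda>v. mean X (\<lambda>v'. F v' * cnj (F v)))"
  unfolding mean_mult_right mean_mult_left mean_cnj
  by (simp add: complex_norm_square del: of_real_power)

lemma mean_PiE_insert:
  assumes "a \<notin> I"
  shows "mean (insert a I \<rightarrow>\<^sub>E B) F = mean B (\<lambda>v. mean (I \<rightarrow>\<^sub>E B) (\<lambda>y. F (y(a := v))))"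
proof -
  have "bij_betw (\<lambda>(v, y). y(a := v)) (B \<times> (I \<rightarrow>\<^sub>E B)) (insert a I \<rightarrow>\<^sub>E B)"
    unfolding PiE_insert_eq bij_betw_def using inj_combinator[OF assms, of "\<lambda>_. B"] by simp
  then have "mean (insert a I \<rightarrow>\<^sub>E B) F = mean (B \<times> (I \<rightarrow>\<^sub>E B)) (\<lambda>q. F ((\<lambda>(v, y). y(a := v)) q))"
    by (rule mean_reindex[symmetric])
  also have "\<dots> = (\<Sum>v\<in>B. \<Sum>y\<in>I \<rightarrow>\<^sub>E B. F (y(a := v))) / of_nat (card B * card (I \<rightarrow>\<^sub>E B))"
    unfolding mean_def card_cartesian_product sum.cartesian_product by (simp add: case_prod_unfold)
  also have "\<dots> = mean B (\<lambda>v. mean (I \<rightarrow>\<^sub>E B) (\<lambda>y. F (y(a := v))))"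
    unfolding mean_def sum_divide_distrib[symmetric] by (simp add: mult.commute)
  finally show ?thesis .
qed

lemma mean_PiE_superset:
  assumes "finite R" "finite B" "B \<noteq> {}" "S \<inter> R = {}"
  shows "(\<And>y a v. a \<notin> S \<Longrightarrow> F (y(a := v)) = F y) \<Longrightarrow> mean (R \<union> S \<rightarrow>\<^sub>E B) F = mean (S \<rightarrow>\<^sub>E B) F"
  using assms
proof (induction R rule: finite_induct)
  case (insert a R)
  then have "mean (insert a R \<union> S \<rightarrow>\<^sub>E B) F = mean B (\<lambda>v. mean (R \<union> S \<rightarrow>\<^sub>E B) (\<lambda>y. F (y(a := v))))"
    by (simp add: mean_PiE_insert)
  also have "\<dots> = mean B (\<lambda>v. mean (R \<union> S \<rightarrow>\<^sub>E B) F)"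
    using insert.prems by (simp add: insert.prems(1) del: fun_upd_apply)
  finally have "mean (insert a R \<union> S \<rightarrow>\<^sub>E B) F = mean B (\<lambda>v. mean (R \<union> S \<rightarrow>\<^sub>E B) F)" .
  then show ?case
    using insert by (simp add: mean_const)
qed simp

text \<open>The coordinates in \<open>R\<close> are frozen one at a time, each at a value where the
  inner mean is at least as large in norm as the outer one; \<open>w\<close> collects these
  values.\<close>

lemma norm_mean_PiE_attained:
  assumes "finite R" "finite B" "B \<noteq> {}" "S \<inter> R = {}"
  shows "\<exists>w. norm (mean (R \<union> S \<rightarrow>\<^sub>E B) F)
           \<le> norm (mean (S \<rightarrow>\<^sub>E B) (\<lambda>y. F (\<lambda>i. if i \<in> R then w i else y i)))"
  using assms
proof (induction R arbitrary: F rule: finite_induct)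
  case (insert a R)
  have "mean (insert a R \<union> S \<rightarrow>\<^sub>E B) F = mean B (\<lambda>v. mean (R \<union> S \<rightarrow>\<^sub>E B) (\<lambda>y. F (y(a := v))))"
    using insert by (simp add: mean_PiE_insert)
  then obtain v where v: "norm (mean (insert a R \<union> S \<rightarrow>\<^sub>E B) F)
      \<le> norm (mean (R \<union> S \<rightarrow>\<^sub>E B) (\<lambda>y. F (y(a := v))))"
    using norm_mean_attained[OF insert.prems(1,2)] by metis
  obtain w where w: "norm (mean (R \<union> S \<rightarrow>\<^sub>E B) (\<lambda>y. F (y(a := v))))
      \<le> norm (mean (S \<rightarrow>\<^sub>E B) (\<lambda>y. F ((\<lambda>i. if i \<in> R then w i else y i)(a := v))))"
    using insert.IH[of "\<lambda>y. F (y(a := v))"] insert.prems by auto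
  have eq: "(\<lambda>i. if i \<in> R then w i else y i)(a := v) = (\<lambda>i. if i \<in> insert a R then (w(a := v)) i else y i)"
    for y using insert.hyps by (auto simp: fun_eq_iff)
  show ?case
    using order_trans[OF v w] unfolding eq by blast
qed simp

section \<open>Additive characters\<close>

lemma add_char_0: "add_char p 0 = 1"
  by (simp add: add_char_def)

lemma add_char_add: "add_char p (a + b) = add_char p a * add_char p b"
  by (simp add: add_char_def exp_add[symmetric] add_divide_distrib[symmetric] algebra_simps)

lemma add_char_sum: "add_char p (\<Sum>i\<in>I. a i) = (\<Prod>i\<in>I. add_char p (a i))"
  by (induction I rule: infinite_finite_induct) (auto simp: add_char_0 add_char_add)

lemma add_char_eq_cis: "add_char p a = cis (2 * pi * of_int a / of_nat p)"
  by (simp add: add_char_def cis_conv_exp mult_ac)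

lemma norm_add_char [simp]: "norm (add_char p a) = 1"
  by (simp add: add_char_eq_cis)

lemma add_char_minus: "add_char p (- a) = cnj (add_char p a)"
  by (simp add: add_char_eq_cis cis_cnj)

lemma add_char_diff: "add_char p (a - b) = add_char p a * cnj (add_char p b)"
  using add_char_add[of p a "- b"] by (simp add: add_char_minus)

lemma add_char_multiple:
  assumes "p > 0" "int p dvd a"
  shows "add_char p a = 1"
proof -
  obtain k where "a = int p * k"
    using assms(2) by blast
  then have "add_char p a = cis (2 * pi * of_int k)"
    using assms(1) by (simp add: add_char_eq_cis mult_ac)
  then show ?thesis
    by (metis Ints_of_int cis_multiple_2pi)
qed

lemma add_char_cong:
  assumes "p > 0" "[a = b] (mod int p)"
  shows "add_char p a = add_char p b"
proof -
  have "add_char p (a - b) = 1"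
    using assms by (intro add_char_multiple) (auto simp: cong_iff_dvd_diff)
  then show ?thesis
    using add_char_add[of p "a - b" b] by simp
qed

lemma add_char_eq_1D:
  assumes "p > 0" "add_char p a = 1"
  shows "int p dvd a"
proof -
  have "cos (2 * pi * of_int a / of_nat p) = 1"
    using assms(2) by (simp add: add_char_eq_cis complex_eq_iff)
  then obtain k :: int where "2 * pi * of_int a / of_nat p = of_int k * 2 * pi"
    unfolding cos_one_2pi_int by auto
  then have "real_of_int a = of_int (int p * k)"
    using assms(1) by (simp add: field_simps)
  then show ?thesis
    by (metis dvd_triv_left of_int_eq_iff)
qed

lemma add_char_of_nat_mult: "add_char p (int l * u) = add_char p u ^ l"
  by (induction l) (auto simp: add_char_0 add_char_add algebra_simps)

lemma sum_add_char:
  assumes "p > 0"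
  shows "(\<Sum>l<p. add_char p (int l * u)) = (if int p dvd u then of_nat p else 0)"
proof (cases "int p dvd u")
  case True
  then show ?thesis
    using assms by (simp add: add_char_multiple)
next
  case False
  then have "add_char p u \<noteq> 1"
    using add_char_eq_1D[OF assms] by blast
  moreover have "add_char p u ^ p = 1"
    using add_char_multiple[OF assms, of "int p * u"] by (simp add: add_char_of_nat_mult)
  ultimately show ?thesis
    using False by (simp add: add_char_of_nat_mult geometric_sum)
qed

text \<open>If \<open>z = e(u)\<close>, the powers of \<open>z\<close> sum to \<open>0\<close> over a period, so the distances \<open>|z\<^sup>l - 1| \<le> l |z - 1|\<close>
  sum to at least \<open>p\<close>.\<close>
lemma norm_add_char_diff_ge:
  assumes "p > 0" "\<not> [a = b] (mod int p)"
  shows "norm (add_char p a - add_char p b) \<ge> 2 / p"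
proof -
  define z where "z = add_char p (a - b)"
  have pow: "norm (z ^ l - 1) \<le> l * norm (z - 1)" for l
  proof (induction l)
    case (Suc l)
    have "norm (z ^ Suc l - 1) = norm (z ^ l * (z - 1) + (z ^ l - 1))"
      by (simp add: algebra_simps)
    also have "\<dots> \<le> norm (z ^ l * (z - 1)) + norm (z ^ l - 1)"
      by (rule norm_triangle_ineq)
    also have "norm (z ^ l * (z - 1)) = norm (z - 1)"
      by (simp add: norm_mult norm_power z_def)
    finally show ?case
      using Suc by (simp add: algebra_simps)
  qed simp
  have "(\<Sum>l<p. z ^ l) = 0"
    using sum_add_char[OF assms(1), of "a - b"] assms(2)
    by (simp add: add_char_of_nat_mult z_def cong_iff_dvd_diff)
  then have "(\<Sum>l<p. z ^ l - 1) = - of_nat p"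
    by (simp add: sum_subtractf)
  then have "real p = norm (\<Sum>l<p. z ^ l - 1)"
    by simp
  also have "\<dots> \<le> (\<Sum>l<p. l * norm (z - 1))"
    by (intro sum_norm_le pow)
  also have "\<dots> = real (\<Sum>l<p. l) * norm (z - 1)"
    by (simp add: sum_distrib_right)
  also have "\<dots> \<le> (real p * real p / 2) * norm (z - 1)"
  proof (intro mult_right_mono)
    have "2 * (\<Sum>l<p. l) \<le> p * p"
      by (induction p) auto
    then have "real (2 * (\<Sum>l<p. l)) \<le> real (p * p)"
      by (rule of_nat_mono)
    then show "real (\<Sum>l<p. l) \<le> real p * real p / 2"
      by simp
  qed simp
  finally have "2 / p \<le> norm (z - 1)"
    using assms(1) by (simp add: field_simps)
  also have "norm (z - 1) = norm ((z - 1) * add_char p b)"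
    by (simp add: norm_mult)
  also have "(z - 1) * add_char p b = add_char p (a - b + b) - add_char p b"
    unfolding z_def add_char_add by (simp add: left_diff_distrib)
  also have "a - b + b = a"
    by simp
  finally show ?thesis .
qed

section \<open>Periodic functions\<close>

text \<open>Vectors are arbitrary functions \<open>nat \<Rightarrow> int\<close>, added pointwise without reduction; a function
  on \<open>F\<^sub>p\<^sup>n\<close> is a function of such vectors that only depends on the first \<open>n\<close> coordinates modulo \<open>p\<close>.\<close>

definition periodic :: "nat \<Rightarrow> nat \<Rightarrow> ((nat \<Rightarrow> int) \<Rightarrow> 'b) \<Rightarrow> bool" where
  "periodic p n F \<longleftrightarrow> (\<forall>x y. (\<forall>i<n. [x i = y i] (mod int p)) \<longrightarrow> F x = F y)"

definition reduce :: "nat \<Rightarrow> nat \<Rightarrow> (nat \<Rightarrow> int) \<Rightarrow> (nat \<Rightarrow> int)" where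
  "reduce p n x = (\<lambda>i\<in>{..<n}. x i mod int p)"

lemma finite_vecs [simp]: "finite (vecs p n)"
  by (simp add: vecs_def Fp_def finite_PiE)

lemma reduce_in_vecs: "p > 0 \<Longrightarrow> reduce p n x \<in> vecs p n"
  by (simp add: reduce_def vecs_def Fp_def)

lemma reduce_id: "x \<in> vecs p n \<Longrightarrow> reduce p n x = x"
  by (auto simp: reduce_def vecs_def Fp_def PiE_iff extensional_def restrict_def fun_eq_iff)

lemma vecs_nonempty [simp]: "p > 0 \<Longrightarrow> vecs p n \<noteq> {}"
  using reduce_in_vecs by blast

lemma card_vecs_pos: "p > 0 \<Longrightarrow> card (vecs p n) > 0"
  by (simp add: card_gt_0_iff)

lemma reduce_cong: "i < n \<Longrightarrow> [reduce p n x i = x i] (mod int p)"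
  by (simp add: reduce_def cong_def)

lemma reduce_eq_iff: "reduce p n x = reduce p n y \<longleftrightarrow> (\<forall>i<n. [x i = y i] (mod int p))"
  by (auto simp: reduce_def cong_def restrict_def fun_eq_iff)

lemma periodicD: "periodic p n F \<Longrightarrow> (\<And>i. i < n \<Longrightarrow> [x i = y i] (mod int p)) \<Longrightarrow> F x = F y"
  by (auto simp: periodic_def)

lemma periodic_reduce: "periodic p n F \<Longrightarrow> F (reduce p n x) = F x"
  by (erule periodicD) (rule reduce_cong)

lemma periodic_reduce_comp: "periodic p n (\<lambda>x. f (reduce p n x))"
  unfolding periodic_def using reduce_eq_iff by metis

lemma periodic_comp: "periodic p n F \<Longrightarrow> periodic p n (\<lambda>x. \<phi> (F x))"
  unfolding periodic_def by metis

lemma periodic_comp2: "periodic p n F \<Longrightarrow> periodic p n G \<Longrightarrow> periodic p n (\<lambda>x. \<phi> (F x) (G x))"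
  unfolding periodic_def by metis

lemma periodic_shift: "periodic p n F \<Longrightarrow> periodic p n (\<lambda>x. F (x + h))"
  unfolding periodic_def by (simp add: cong_add)

lemma periodic_shift_left: "periodic p n F \<Longrightarrow> periodic p n (\<lambda>x. F (h + x))"
  using periodic_shift[of p n F h] by (simp add: add.commute)

lemma periodic_sum:
  "(\<And>i. i \<in> I \<Longrightarrow> periodic p n (F i)) \<Longrightarrow> periodic p n (\<lambda>x. \<Sum>i\<in>I. F i x)"
  unfolding periodic_def by (metis (no_types, lifting) sum.cong)

text \<open>Injectivity modulo \<open>p\<close> already makes the reduced map a bijection of the
  finite set \<open>vecs p n\<close>, so shifts and dilations can be treated without exhibiting
  inverses.\<close>

lemma mean_inj_reindex:
  assumes "p > 0" "periodic p n F"
    and inj: "\<And>x y. x \<in> vecs p n \<Longrightarrow> y \<in> vecs p n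
      \<Longrightarrow> (\<forall>i<n. [\<phi> x i = \<phi> y i] (mod int p)) \<Longrightarrow> (\<forall>i<n. [x i = y i] (mod int p))"
  shows "mean (vecs p n) (\<lambda>x. F (\<phi> x)) = mean (vecs p n) F"
proof -
  have "inj_on (\<lambda>x. reduce p n (\<phi> x)) (vecs p n)"
  proof (rule inj_onI)
    fix x y assume "x \<in> vecs p n" "y \<in> vecs p n" "reduce p n (\<phi> x) = reduce p n (\<phi> y)"
    then show "x = y"
      using inj[of x y] unfolding reduce_eq_iff by (metis reduce_eq_iff reduce_id)
  qed
  then have "bij_betw (\<lambda>x. reduce p n (\<phi> x)) (vecs p n) (vecs p n)"
    by (simp add: bij_betw_def endo_inj_surj image_subset_iff reduce_in_vecs[OF assms(1)])
  from mean_reindex[OF this, of F] show ?thesis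
    by (simp add: periodic_reduce[OF assms(2)])
qed

lemma mean_shift:
  assumes "p > 0" "periodic p n F"
  shows "mean (vecs p n) (\<lambda>x. F (x + h)) = mean (vecs p n) F"
  by (rule mean_inj_reindex[OF assms]) (simp add: cong_add_rcancel)

lemma mean_scale:
  assumes "p > 0" "periodic p n F" "coprime u (int p)"
  shows "mean (vecs p n) (\<lambda>x. F (of_int u * x)) = mean (vecs p n) F"
proof -
  have "of_int u = (\<lambda>_::nat. u)"
    by (cases u) (auto simp: fun_eq_iff)
  then show ?thesis
    using assms(3)
    by (intro mean_inj_reindex[OF assms(1,2)]) (auto simp: times_fun_def cong_mult_lcancel)
qed

section \<open>Finite differences\<close>

definition fdiff :: "('a::ab_group_add) \<Rightarrow> ('a \<Rightarrow> int) \<Rightarrow> 'a \<Rightarrow> int" where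
  "fdiff h f x = f (x + h) - f x"

primrec fdiffs :: "('a::ab_group_add) list \<Rightarrow> ('a \<Rightarrow> int) \<Rightarrow> 'a \<Rightarrow> int" where
  "fdiffs [] f = f"
| "fdiffs (w # ws) f = fdiff w (fdiffs ws f)"

text \<open>Degree is measured by vanishing of iterated differences instead of coefficients, so that
  it passes directly to differences, shifts and additive substitutions. The bound is strict:
  \<open>k = 0\<close> is the zero function modulo \<open>p\<close>, where the induction on the
  degree starts.\<close>

primrec deg_less :: "nat \<Rightarrow> nat \<Rightarrow> (('a::ab_group_add) \<Rightarrow> int) \<Rightarrow> bool" where
  "deg_less p 0 f \<longleftrightarrow> (\<forall>x. [f x = 0] (mod int p))"
| "deg_less p (Suc k) f \<longleftrightarrow> (\<forall>h. deg_less p k (fdiff h f))"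

lemma fdiff_commute: "fdiff h (fdiff w f) = fdiff w (fdiff h f)"
  by (simp add: fdiff_def fun_eq_iff algebra_simps)

lemma fdiffs_fdiff: "fdiffs ws (fdiff w f) = fdiff w (fdiffs ws f)"
  by (induction ws) (simp_all add: fdiff_commute[of w])

lemma fdiff_fdiff: "fdiff h (fdiff w f) x = fdiff (h + w) f x - fdiff w f x - fdiff h f x"
  by (simp add: fdiff_def algebra_simps)

lemma fdiff_comp_shift: "fdiff h (\<lambda>x. f (x + a)) = (\<lambda>x. fdiff h f (x + a))"
  by (simp add: fdiff_def fun_eq_iff algebra_simps)

lemma fdiff_sum: "fdiff h (\<lambda>x. \<Sum>i\<in>I. c i * f i x) = (\<lambda>x. \<Sum>i\<in>I. c i * fdiff h (f i) x)"
  by (simp add: fdiff_def fun_eq_iff sum_subtractf right_diff_distrib)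

lemma deg_less_cong:
  "(\<And>x. [f x = g x] (mod int p)) \<Longrightarrow> deg_less p k f \<Longrightarrow> deg_less p k g"
proof (induction k arbitrary: f g)
  case 0
  then show ?case
    by simp (meson cong_sym cong_trans)
next
  case (Suc k)
  have "[fdiff h f x = fdiff h g x] (mod int p)" for h x
    unfolding fdiff_def by (intro cong_diff Suc.prems)
  then show ?case
    using Suc by (metis deg_less.simps(2))
qed

lemma deg_less_Suc: "deg_less p k f \<Longrightarrow> deg_less p (Suc k) f"
proof (induction k arbitrary: f)
  case 0
  then show ?case
    by (auto simp: fdiff_def cong_0_iff)
next
  case (Suc k)
  then show ?case
    by (metis deg_less.simps(2))
qed

lemma deg_less_mono: "j \<le> k \<Longrightarrow> deg_less p j f \<Longrightarrow> deg_less p k f"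
  by (induction k rule: dec_induct) (auto intro: deg_less_Suc simp del: deg_less.simps)

lemma deg_less_fdiff: "deg_less p k f \<Longrightarrow> deg_less p (k - 1) (fdiff h f)"
  by (cases k) (auto simp: fdiff_def cong_0_iff)

lemma deg_less_fdiffs: "deg_less p k f \<Longrightarrow> deg_less p (k - length ws) (fdiffs ws f)"
proof (induction ws)
  case (Cons w ws)
  then show ?case
    using deg_less_fdiff[of p "k - length ws" "fdiffs ws f" w] by simp
qed simp

lemma deg_less_shift: "deg_less p k f \<Longrightarrow> deg_less p k (\<lambda>x. f (x + a))"
  by (induction k arbitrary: f) (auto simp: fdiff_comp_shift)

lemma deg_less_sum:
  "(\<And>i. i \<in> I \<Longrightarrow> deg_less p k (f i)) \<Longrightarrow> deg_less p k (\<lambda>x. \<Sum>i\<in>I. c i * f i x)"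
proof (induction k arbitrary: f)
  case 0
  then show ?case
    by (auto simp: cong_0_iff intro!: dvd_sum)
qed (auto simp: fdiff_sum)

lemma deg_less_diff: "deg_less p k f \<Longrightarrow> deg_less p k g \<Longrightarrow> deg_less p k (\<lambda>x. f x - g x)"
proof (induction k arbitrary: f g)
  case 0
  then show ?case
    by (auto simp: cong_0_iff)
next
  case (Suc k)
  have "fdiff h (\<lambda>x. f x - g x) = (\<lambda>x. fdiff h f x - fdiff h g x)" for h
    by (simp add: fdiff_def fun_eq_iff)
  then show ?case
    using Suc by simp
qed

text \<open>Differencing commutes with an additive substitution, the direction \<open>h\<close>
  becoming \<open>\<phi> h\<close>. Hence a vertex of a cube, as a function of base point and
  directions together, does not raise the degree.\<close>

lemma deg_less_hom:
  assumes "\<And>x y. \<phi> (x + y) = \<phi> x + \<phi> y"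
  shows "deg_less p k f \<Longrightarrow> deg_less p k (\<lambda>x. f (\<phi> x))"
proof (induction k arbitrary: f)
  case (Suc k)
  have "fdiff h (\<lambda>x. f (\<phi> x)) = (\<lambda>x. fdiff (\<phi> h) f (\<phi> x))" for h
    by (simp add: fdiff_def fun_eq_iff assms)
  then show ?case
    using Suc by simp
qed simp

lemma periodic_fdiff: "periodic p n f \<Longrightarrow> periodic p n (fdiff h f)"
  unfolding fdiff_def[abs_def]
  using periodic_comp2[OF periodic_shift, where \<phi> = "(-)"] by blast

lemma periodic_fdiffs: "periodic p n f \<Longrightarrow> periodic p n (fdiffs ws f)"
  by (induction ws) (auto intro: periodic_fdiff)

text \<open>An iterated difference is an integer combination of single differences.\<close>

primrec partial_sums :: "('a::ab_group_add) list \<Rightarrow> 'a set" where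
  "partial_sums [] = {}"
| "partial_sums (w # ws) = insert w (partial_sums ws \<union> (\<lambda>h. h + w) ` partial_sums ws)"

lemma finite_partial_sums: "finite (partial_sums ws)"
  by (induction ws) auto

lemma card_partial_sums: "card (partial_sums ws) < 2 ^ length ws"
proof (induction ws)
  case (Cons w ws)
  let ?P = "partial_sums ws"
  have "card (partial_sums (w # ws)) \<le> Suc (card (?P \<union> (\<lambda>h. h + w) ` ?P))"
    by (simp add: card_insert_le_m1 finite_partial_sums)
  also have "card (?P \<union> (\<lambda>h. h + w) ` ?P) \<le> card ?P + card ?P"
    by (meson add_left_mono card_Un_le card_image_le finite_partial_sums le_trans)
  finally show ?case
    using Cons.IH by simp
qed simp

text \<open>Induction with one difference moved inside, \<open>fdiffs (w # ws) f\<close> being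
  \<open>fdiffs ws (fdiff w f)\<close>. The hypothesis for \<open>fdiff w f\<close> comes from
  \<open>D_h D_w f = D_(h+w) f - D_w f - D_h f\<close>, which is the reason for the recursion of
  \<open>partial_sums\<close>. For the empty list the claim would speak of \<open>f\<close>
  itself.\<close>

lemma fdiffs_determined:
  "\<lbrakk>ws \<noteq> []; \<And>h. h \<in> partial_sums ws \<Longrightarrow> [fdiff h f x = fdiff h f x'] (mod m)\<rbrakk>
    \<Longrightarrow> [fdiffs ws f x = fdiffs ws f x'] (mod m)"
proof (induction ws arbitrary: f)
  case (Cons w ws)
  show ?case
  proof (cases "ws = []")
    case True
    then show ?thesis
      using Cons.prems by simp
  next
    case False
    have "[fdiffs ws (fdiff w f) x = fdiffs ws (fdiff w f) x'] (mod m)"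
      unfolding fdiff_fdiff[of _ w]
      using Cons.prems(2) by (intro Cons.IH[OF False]) (auto simp: fdiff_fdiff intro!: cong_diff)
    then show ?thesis
      by (simp add: fdiffs_fdiff)
  qed
qed simp

section \<open>Sampling along a random grid\<close>

text \<open>The ring structure serves to write multiples of a direction: for functions with
  pointwise operations, \<open>of_nat a * h\<close> is the \<open>a\<close>-fold sum of
  \<open>h\<close>.\<close>

primrec grid :: "nat \<Rightarrow> ('a::comm_ring_1) list \<Rightarrow> 'a set" where
  "grid M [] = {0}"
| "grid M (h # hs) = (\<lambda>(a, z). of_nat a * h + z) ` ({..<M} \<times> grid M hs)"

lemma finite_grid: "finite (grid M hs)"
  by (induction hs) auto

lemma card_grid: "card (grid M hs) \<le> M ^ length hs"
proof (induction hs)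
  case (Cons h hs)
  have "card (grid M (h # hs)) \<le> card ({..<M} \<times> grid M hs)"
    unfolding grid.simps by (intro card_image_le) (simp add: finite_grid)
  also have "\<dots> \<le> M * M ^ length hs"
    unfolding card_cartesian_product using Cons by (simp add: mult_le_mono2)
  finally show ?case
    by simp
qed simp

text \<open>If \<open>f\<close> vanishes at \<open>k + 1\<close> consecutive points, its difference
  along the progression vanishes at \<open>k\<close> of them, hence everywhere on it by induction.
  So \<open>f\<close> is constant along the progression, with the value 0 at its start.\<close>

lemma deg_less_vanish_progression:
  fixes f :: "'a::comm_ring_1 \<Rightarrow> int"
  shows "\<lbrakk>deg_less p k f; \<And>a. a < k \<Longrightarrow> [f (of_nat a * h + z) = 0] (mod int p)\<rbrakk>
    \<Longrightarrow> [f (of_nat a * h + z) = 0] (mod int p)"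
proof (induction k arbitrary: f a)
  case (Suc k)
  have step: "fdiff h f (of_nat a * h + z) = f (of_nat (Suc a) * h + z) - f (of_nat a * h + z)" for a
    by (simp add: fdiff_def algebra_simps)
  have diff: "[fdiff h f (of_nat a * h + z) = 0] (mod int p)" for a
  proof (rule Suc.IH)
    show "deg_less p k (fdiff h f)"
      using Suc.prems(1) by simp
    show "[fdiff h f (of_nat a * h + z) = 0] (mod int p)" if "a < k" for a
      using Suc.prems(2)[of a] Suc.prems(2)[of "Suc a"] that
      unfolding step by (simp add: cong_0_iff del: of_nat_Suc)
  qed
  show ?case
  proof (induction a)
    case 0
    then show ?case
      using Suc.prems(2)[of 0] by simp
  next
    case (Suc a)
    have "f (of_nat (Suc a) * h + z) = fdiff h f (of_nat a * h + z) + f (of_nat a * h + z)"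
      unfolding step by simp
    then show ?case
      using Suc diff[of a] unfolding cong_0_iff by (metis dvd_add)
  qed
qed simp

lemma deg_less_vanish_grid:
  fixes f :: "'a::comm_ring_1 \<Rightarrow> int"
  shows "\<lbrakk>deg_less p k f; \<And>z. z \<in> grid k hs \<Longrightarrow> [f z = 0] (mod int p); z \<in> grid M hs\<rbrakk>
    \<Longrightarrow> [f z = 0] (mod int p)"
proof (induction hs arbitrary: f z)
  case (Cons h hs)
  obtain a z' where z: "z = of_nat a * h + z'" "z' \<in> grid M hs"
    using Cons.prems(3) by auto
  have "[f (of_nat b * h + z') = 0] (mod int p)" if "b < k" for b
  proof -
    have "[(\<lambda>x. f (x + of_nat b * h)) z' = 0] (mod int p)"
    proof (rule Cons.IH[OF deg_less_shift[OF Cons.prems(1)] _ z(2)])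
      show "[f (y + of_nat b * h) = 0] (mod int p)" if "y \<in> grid k hs" for y
        using Cons.prems(2)[of "of_nat b * h + y"] that \<open>b < k\<close> by (force simp: add.commute)
    qed
    then show ?thesis
      by (simp add: add.commute)
  qed
  from deg_less_vanish_progression[OF Cons.prems(1) this] show ?case
    unfolding z(1) .
qed simp

primrec grid_avg :: "nat \<Rightarrow> ('a::comm_ring_1) list \<Rightarrow> ('a \<Rightarrow> complex) \<Rightarrow> 'a \<Rightarrow> complex" where
  "grid_avg p [] F = F"
| "grid_avg p (h # hs) F = grid_avg p hs (\<lambda>x. mean {..<p} (\<lambda>a. F (x + of_nat a * h)))"

lemma grid_avg_diff_const:
  assumes "p > 0"
  shows "grid_avg p hs (\<lambda>x. F x - c) x = grid_avg p hs F x - c"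
proof (induction hs arbitrary: F)
  case (Cons h hs)
  have "(\<lambda>x. mean {..<p} (\<lambda>a. F (x + of_nat a * h) - c))
      = (\<lambda>x. mean {..<p} (\<lambda>a. F (x + of_nat a * h)) - c)"
    using assms by (simp add: mean_def fun_eq_iff sum_subtractf diff_divide_distrib)
  then show ?case
    using Cons by simp
qed simp

text \<open>Meant for \<open>c\<close> and \<open>c'\<close> equal to the conjugates of
  \<open>F x\<close> and \<open>F x'\<close>: the hypothesis then compares increments of the phase,
  not its values.\<close>

lemma grid_avg_transfer:
  "(\<And>z. z \<in> grid p hs \<Longrightarrow> F (x + z) * c = F (x' + z) * c')
    \<Longrightarrow> grid_avg p hs F x * c = grid_avg p hs F x' * c'"
proof (induction hs arbitrary: F)
  case (Cons h hs)
  have "F (x + z + of_nat a * h) * c = F (x' + z + of_nat a * h) * c'" if "z \<in> grid p hs" "a < p" for z a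
    using Cons.prems[of "of_nat a * h + z"] that by (force simp: algebra_simps)
  then have "mean {..<p} (\<lambda>a. F (x + z + of_nat a * h)) * c
      = mean {..<p} (\<lambda>a. F (x' + z + of_nat a * h)) * c'" if "z \<in> grid p hs" for z
    unfolding mean_mult_right[symmetric] using that by (intro mean_cong) auto
  then show ?case
    unfolding grid_avg.simps by (rule Cons.IH)
qed simp

lemma periodic_mean:
  "(\<And>a. periodic p n (F a)) \<Longrightarrow> periodic p n (\<lambda>x. mean A (\<lambda>a. F a x))"
  unfolding periodic_def by (metis (no_types, lifting) mean_cong)

lemma periodic_grid_avg: "periodic p n F \<Longrightarrow> periodic p n (grid_avg p hs F)"
proof (induction hs arbitrary: F)
  case (Cons h hs)
  have "periodic p n (\<lambda>x. mean {..<p} (\<lambda>a. F (x + of_nat a * h)))"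
    by (rule periodic_mean[OF periodic_shift[OF Cons.prems]])
  then show ?case
    unfolding grid_avg.simps by (rule Cons.IH)
qed simp

lemma coprime_diff_residues:
  assumes "prime p" "a < p" "b < p" "a \<noteq> b"
  shows "coprime (int b - int a) (int p)"
proof -
  have "\<not> int p dvd int b - int a"
  proof
    assume "int p dvd int b - int a"
    then have "\<bar>int p\<bar> \<le> \<bar>int b - int a\<bar>"
      using assms(4) by (intro dvd_imp_le_int) auto
    then show False
      using assms(2,3) by linarith
  qed
  then show ?thesis
    using assms(1) by (metis coprime_commute prime_imp_coprime prime_nat_int_transfer)
qed

text \<open>Distinct points of the random line \<open>x + F\<^sub>p h\<close> are independent, so only the diagonal terms of
  the second moment survive.\<close>

lemma second_moment_line:
  fixes F :: "(nat \<Rightarrow> int) \<Rightarrow> complex"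
  assumes p: "prime p" and F: "periodic p n F" and zero: "mean (vecs p n) F = 0"
  shows "\<exists>h. mean (vecs p n) (\<lambda>x. (norm (mean {..<p} (\<lambda>a. F (x + of_nat a * h))))\<^sup>2)
      \<le> mean (vecs p n) (\<lambda>x. (norm (F x))\<^sup>2) / p"
proof -
  let ?B = "vecs p n" and ?P = "{..<p}"
  let ?L = "\<lambda>h. mean ?B (\<lambda>x. (norm (mean ?P (\<lambda>a. F (x + of_nat a * h))))\<^sup>2)"
  have p0: "p > 0"
    using p by (simp add: prime_gt_0_nat)
  define m where "m = mean ?B (\<lambda>x. (norm (F x))\<^sup>2)"
  have corr: "mean ?B (\<lambda>h. mean ?B (\<lambda>x. F (x + of_nat b * h) * cnj (F (x + of_nat a * h))))
      = (if a = b then of_real m else 0)" if "a \<in> ?P" "b \<in> ?P" for a b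
  proof -
    have shift: "mean ?B (\<lambda>x. F (x + of_nat b * h) * cnj (F (x + of_nat a * h)))
        = mean ?B (\<lambda>x. F (x + of_int (int b - int a) * h) * cnj (F x))" for h
    proof -
      have "periodic p n (\<lambda>x. F (x + of_int (int b - int a) * h) * cnj (F x))"
        by (intro periodic_comp2[where \<phi> = "\<lambda>u v. u * cnj v"] periodic_shift F)
      from mean_shift[OF p0 this, of "of_nat a * h"] show ?thesis
        by (simp add: algebra_simps)
    qed
    show ?thesis
    proof (cases "a = b")
      case True
      have "F x * cnj (F x) = of_real ((norm (F x))\<^sup>2)" for x
        by (simp add: complex_norm_square del: of_real_power)
      then show ?thesis
        using True p0 unfolding shift m_def mean_of_real[symmetric] by (simp add: mean_const)
    next
      case False
      have "mean ?B (\<lambda>h. mean ?B (\<lambda>x. F (x + of_int (int b - int a) * h) * cnj (F x)))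
          = mean ?B (\<lambda>x. mean ?B (\<lambda>h. F (x + of_int (int b - int a) * h)) * cnj (F x))"
        by (subst mean_swap) (simp add: mean_mult_right)
      also have "\<dots> = mean ?B (\<lambda>x. 0 * cnj (F x))"
      proof (intro mean_cong arg_cong2[where f = "(*)"] refl)
        fix x
        have "mean ?B (\<lambda>h. F (x + of_int (int b - int a) * h)) = mean ?B (\<lambda>h. F (x + h))"
          using False that
          by (intro mean_scale[OF p0 periodic_shift_left[OF F]] coprime_diff_residues[OF p]) auto
        also have "\<dots> = 0"
          using mean_shift[OF p0 F, of x] zero by (simp add: add.commute)
        finally show "mean ?B (\<lambda>h. F (x + of_int (int b - int a) * h)) = 0" .
      qed
      finally show ?thesis
        using False unfolding shift by (simp add: mean_def)
    qed
  qed
  have "of_real (mean ?B ?L) = mean ?B (\<lambda>h. mean ?B (\<lambda>x. mean ?P (\<lambda>a. mean ?P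
      (\<lambda>b. F (x + of_nat b * h) * cnj (F (x + of_nat a * h))))))"
    unfolding mean_of_real[symmetric] norm_mean_square ..
  also have "\<dots> = mean ?P (\<lambda>a. mean ?P (\<lambda>b. mean ?B (\<lambda>h. mean ?B
      (\<lambda>x. F (x + of_nat b * h) * cnj (F (x + of_nat a * h))))))"
    unfolding mean_swap[of ?B ?P] ..
  also have "\<dots> = mean ?P (\<lambda>a. mean ?P (\<lambda>b. if a = b then of_real m else 0))"
    by (intro mean_cong corr)
  also have "\<dots> = of_real (m / p)"
    using p0 by (simp add: mean_def)
  finally have "mean ?B ?L = m / p"
    using of_real_eq_iff by blast
  then show ?thesis
    using mean_le_attained[of ?B ?L] p0 unfolding m_def by auto
qed

text \<open>Averaging along a line preserves mean zero, so the gain of a factor \<open>p\<close> can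
  be repeated: each direction is chosen for the function already averaged along the earlier
  ones.\<close>

lemma second_moment_grid:
  fixes F :: "(nat \<Rightarrow> int) \<Rightarrow> complex"
  assumes p: "prime p"
  shows "\<lbrakk>periodic p n F; mean (vecs p n) F = 0\<rbrakk> \<Longrightarrow> \<exists>hs. length hs = r \<and>
      mean (vecs p n) (\<lambda>x. (norm (grid_avg p hs F x))\<^sup>2) \<le> mean (vecs p n) (\<lambda>x. (norm (F x))\<^sup>2) / p ^ r"
proof (induction r arbitrary: F)
  case (Suc r)
  have p0: "p > 0"
    using p by (simp add: prime_gt_0_nat)
  obtain h where h: "mean (vecs p n) (\<lambda>x. (norm (mean {..<p} (\<lambda>a. F (x + of_nat a * h))))\<^sup>2)
      \<le> mean (vecs p n) (\<lambda>x. (norm (F x))\<^sup>2) / p"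
    using second_moment_line[OF p Suc.prems] by blast
  let ?F = "\<lambda>x. mean {..<p} (\<lambda>a. F (x + of_nat a * h))"
  have "periodic p n ?F"
    by (intro periodic_mean periodic_shift Suc.prems)
  moreover have "mean (vecs p n) ?F = 0"
    using p0 by (subst mean_swap) (simp add: mean_shift Suc.prems mean_const mean_def[of "{..<p}"])
  ultimately obtain hs where hs: "length hs = r"
      "mean (vecs p n) (\<lambda>x. (norm (grid_avg p hs ?F x))\<^sup>2) \<le> mean (vecs p n) (\<lambda>x. (norm (?F x))\<^sup>2) / p ^ r"
    using Suc.IH by blast
  note hs(2)
  also have "mean (vecs p n) (\<lambda>x. (norm (?F x))\<^sup>2) / p ^ r \<le> mean (vecs p n) (\<lambda>x. (norm (F x))\<^sup>2) / p / p ^ r"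
    by (intro divide_right_mono h) simp
  finally show ?case
    using hs(1) by (intro exI[of _ "h # hs"]) simp
qed simp

text \<open>Chebyshev's inequality for the grid average around its mean \<open>\<mu>\<close>.
  Multiplied by the conjugate of e(f(x)), the grid average depends only on increments of
  \<open>f\<close>, and these are fixed by the derivatives in the directions of the small
  grid.\<close>

lemma biased_determined_mostly:
  fixes f :: "(nat \<Rightarrow> int) \<Rightarrow> int"
  assumes p: "prime p" and f: "periodic p n f" "deg_less p k f"
    and bias: "norm (mean (vecs p n) (\<lambda>x. add_char p (f x))) \<ge> 1 / real p ^ s"
  shows "\<exists>H Good. finite H \<and> card H \<le> k ^ (2 * s + 2 + r) \<and> periodic p n Good \<and>
    real (card {x \<in> vecs p n. \<not> Good x}) \<le> card (vecs p n) / 2 ^ r \<and>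
    (\<forall>x x'. Good x \<longrightarrow> Good x' \<longrightarrow> (\<forall>h\<in>H. [fdiff h f x = fdiff h f x'] (mod int p)) \<longrightarrow>
      [f x = f x'] (mod int p))"
proof -
  let ?B = "vecs p n" and ?e = "\<lambda>x. add_char p (f x)"
  define \<mu> where "\<mu> = mean ?B ?e"
  \<comment> \<open>A good point may deviate by \<open>norm \<mu> / p\<close>, which is at least
    \<open>1 / p ^ (s + 1)\<close>. Its square uses up \<open>2 * s + 2\<close> directions; the
    other \<open>r\<close> push the bad set down to a fraction \<open>1 / p ^ r\<close>.\<close>
  define q where "q = 2 * s + 2 + r"
  have p0: "p > 0"
    using p by (simp add: prime_gt_0_nat)
  have \<mu>: "norm \<mu> \<ge> 1 / real p ^ s"
    using bias unfolding \<mu>_def by simp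
  have "0 < 1 / real p ^ s"
    using p0 by simp
  then have \<mu>_pos: "norm \<mu> > 0"
    using \<mu> by linarith
  have pe: "periodic p n ?e"
    by (rule periodic_comp[OF f(1)])
  have B: "finite ?B" "?B \<noteq> {}"
    using p0 by auto
  have m0: "mean ?B (\<lambda>x. ?e x - \<mu>) = 0"
    using mean_add[of ?B ?e "\<lambda>_. - \<mu>"] mean_const[OF B, of "- \<mu>"] by (simp add: \<mu>_def)
  obtain hs where hs: "length hs = q"
    "mean ?B (\<lambda>x. (norm (grid_avg p hs (\<lambda>x. ?e x - \<mu>) x))\<^sup>2) \<le> mean ?B (\<lambda>x. (norm (?e x - \<mu>))\<^sup>2) / p ^ q"
    using second_moment_grid[OF p _ m0, of q] periodic_comp[OF pe, of "\<lambda>z. z - \<mu>"] by blast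
  have var: "mean ?B (\<lambda>x. (norm (?e x - \<mu>))\<^sup>2) \<le> 1"
  proof -
    have "(norm (?e x - \<mu>))\<^sup>2 = (1 + (norm \<mu>)\<^sup>2) + (- 2) * Re (?e x * cnj \<mu>)" for x
    proof -
      have "(norm (?e x))\<^sup>2 = 1"
        by simp
      then show ?thesis
        unfolding cmod_power2 by (simp add: power2_eq_square algebra_simps)
    qed
    then have "mean ?B (\<lambda>x. (norm (?e x - \<mu>))\<^sup>2)
        = mean ?B (\<lambda>x. (1 + (norm \<mu>)\<^sup>2) + (- 2) * Re (?e x * cnj \<mu>))"
      by (simp only:)
    also have "\<dots> = 1 + (norm \<mu>)\<^sup>2 - 2 * Re (\<mu> * cnj \<mu>)"
      unfolding mean_add mean_mult_left mean_Re mean_mult_right \<mu>_def[symmetric] mean_const[OF B] by simp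
    also have "\<dots> \<le> 1"
      by (simp add: complex_mult_cnj cmod_power2)
    finally show ?thesis .
  qed
  let ?A = "\<lambda>x. grid_avg p hs ?e x - \<mu>"
  \<comment> \<open>The margin matches the spacing of the characters: two good points with the same
    increments satisfy |e(f(x)) - e(f(x'))| < 2/p, whereas distinct residues are at least 2/p
    apart.\<close>
  define Good where "Good x \<longleftrightarrow> norm (?A x) < norm \<mu> / p" for x
  have perA: "periodic p n (grid_avg p hs ?e)"
    by (rule periodic_grid_avg[OF pe])
  have "real (card {x \<in> ?B. \<not> Good x}) * (norm \<mu> / p)\<^sup>2 \<le> (\<Sum>x\<in>{x \<in> ?B. \<not> Good x}. (norm (?A x))\<^sup>2)"
  proof -
    have "(\<Sum>x\<in>{x \<in> ?B. \<not> Good x}. (norm \<mu> / p)\<^sup>2) \<le> (\<Sum>x\<in>{x \<in> ?B. \<not> Good x}. (norm (?A x))\<^sup>2)"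
      by (intro sum_mono power_mono) (auto simp: Good_def)
    then show ?thesis
      by simp
  qed
  also have "\<dots> \<le> (\<Sum>x\<in>?B. (norm (?A x))\<^sup>2)"
    by (intro sum_mono2) auto
  also have "\<dots> = mean ?B (\<lambda>x. (norm (?A x))\<^sup>2) * card ?B"
    using card_vecs_pos[OF p0, of n] by (simp add: mean_def)
  also have "\<dots> \<le> 1 / p ^ q * card ?B"
  proof (intro mult_right_mono)
    have "mean ?B (\<lambda>x. (norm (?A x))\<^sup>2) \<le> mean ?B (\<lambda>x. (norm (?e x - \<mu>))\<^sup>2) / p ^ q"
      using hs(2) by (simp add: grid_avg_diff_const[OF p0])
    also have "\<dots> \<le> 1 / p ^ q"
      by (intro divide_right_mono var) simp
    finally show "mean ?B (\<lambda>x. (norm (?A x))\<^sup>2) \<le> 1 / p ^ q" .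
  qed simp
  finally have bad: "real (card {x \<in> ?B. \<not> Good x}) * (norm \<mu> / p)\<^sup>2 \<le> 1 / p ^ q * card ?B" .
  have "real (card {x \<in> ?B. \<not> Good x}) \<le> card ?B / 2 ^ r"
  proof -
    have "real (card {x \<in> ?B. \<not> Good x}) * (1 / real p ^ s / p)\<^sup>2 \<le> real (card {x \<in> ?B. \<not> Good x}) * (norm \<mu> / p)\<^sup>2"
      by (intro mult_left_mono power_mono divide_right_mono \<mu>) auto
    also note bad
    also have "(1 / real p ^ s / p)\<^sup>2 = 1 / p ^ (2 * s + 2)"
      by (simp add: power_divide power_mult_distrib power_add power_mult power2_eq_square)
    finally have "real (card {x \<in> ?B. \<not> Good x}) * (1 / p ^ (2 * s + 2)) \<le> 1 / p ^ q * card ?B" .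
    then have "real (card {x \<in> ?B. \<not> Good x}) \<le> card ?B / p ^ r"
      using p0 by (simp add: q_def power_add field_simps)
    also have "\<dots> \<le> card ?B / 2 ^ r"
    proof (intro divide_left_mono)
      show "2 ^ r \<le> real (p ^ r)"
        using power_mono[of 2 "real p" r] prime_ge_2_nat[OF p] by simp
    qed (use p0 in auto)
    finally show ?thesis .
  qed
  moreover have "[f x = f x'] (mod int p)"
    if good: "Good x" "Good x'" and H: "\<forall>h\<in>grid k hs. [fdiff h f x = fdiff h f x'] (mod int p)" for x x'
  proof (rule ccontr)
    assume neq: "\<not> ?thesis"
    then have far: "norm (?e x - ?e x') \<ge> 2 / p"
      by (rule norm_add_char_diff_ge[OF p0])
    have "k \<noteq> 0"
    proof
      assume "k = 0"
      then have "[f x = 0] (mod int p)" "[f x' = 0] (mod int p)"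
        using f(2) by auto
      then show False
        using neq cong_sym cong_trans by blast
    qed
    \<comment> \<open>The increment of \<open>f\<close> from \<open>x\<close> minus that from
      \<open>x'\<close>, as a function of the displacement. The constant it contains has degree less
      than \<open>k\<close> because \<open>k\<close> is positive.\<close>
    let ?\<psi> = "\<lambda>z. f (z + x) - f (z + x') - (f x - f x')"
    have "deg_less p 1 (\<lambda>z. f x - f x')"
      by (simp add: fdiff_def)
    then have "deg_less p k (\<lambda>z. f x - f x')"
      using \<open>k \<noteq> 0\<close> by (intro deg_less_mono[of 1 k]) auto
    from deg_less_diff[OF deg_less_diff[OF deg_less_shift[OF f(2)] deg_less_shift[OF f(2)]] this]
    have deg: "deg_less p k ?\<psi>" .
    have "[?\<psi> z = 0] (mod int p)" if "z \<in> grid k hs" for z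
      using H that by (auto simp: fdiff_def cong_iff_dvd_diff algebra_simps)
    then have vanish: "[?\<psi> z = 0] (mod int p)" if "z \<in> grid p hs" for z
      using deg_less_vanish_grid[OF deg _ that] by blast
    have \<psi>: "[f (x + z) - f x = f (x' + z) - f x'] (mod int p)" if "z \<in> grid p hs" for z
      using vanish[OF that] by (simp add: cong_iff_dvd_diff algebra_simps)
    have "?e (x + z) * cnj (?e x) = ?e (x' + z) * cnj (?e x')" if "z \<in> grid p hs" for z
      unfolding add_char_diff[symmetric] by (rule add_char_cong[OF p0 \<psi>[OF that]])
    from grid_avg_transfer[of p hs, OF this]
    have w: "grid_avg p hs ?e x * cnj (?e x) = grid_avg p hs ?e x' * cnj (?e x')" .
    have "norm (?A y) = norm (grid_avg p hs ?e y * cnj (?e y) - \<mu> * cnj (?e y))" for y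
      unfolding left_diff_distrib[symmetric] norm_mult by simp
    then have "norm (\<mu> * cnj (?e x') - \<mu> * cnj (?e x)) \<le> norm (?A x) + norm (?A x')"
      using w norm_triangle_ineq4[of "grid_avg p hs ?e x * cnj (?e x) - \<mu> * cnj (?e x)"
          "grid_avg p hs ?e x' * cnj (?e x') - \<mu> * cnj (?e x')"] by simp
    also have "\<dots> < 2 * norm \<mu> / p"
      using good by (simp add: Good_def)
    also have "norm (\<mu> * cnj (?e x') - \<mu> * cnj (?e x)) = norm \<mu> * norm (?e x - ?e x')"
      unfolding right_diff_distrib[symmetric] norm_mult complex_cnj_diff[symmetric] complex_mod_cnj
      by (simp add: norm_minus_commute)
    finally have "norm \<mu> * norm (?e x - ?e x') < norm \<mu> * (2 / p)"
      by (simp add: mult_ac)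
    then have "norm (?e x - ?e x') < 2 / p"
      using \<mu>_pos mult_less_cancel_left_pos by blast
    then show False
      using far by simp
  qed
  moreover have "card (grid k hs) \<le> k ^ (2 * s + 2 + r)"
    using card_grid[of k hs] hs(1) by (simp add: q_def)
  moreover have "periodic p n Good"
    unfolding Good_def[abs_def]
    by (rule periodic_comp[OF perA, where \<phi> = "\<lambda>w. norm (w - \<mu>) < norm \<mu> / p"])
  ultimately show ?thesis
    by (intro exI[of _ "grid k hs"] exI[of _ Good]) (simp add: finite_grid)
qed

section \<open>Cubes and the Gowers-Cauchy-Schwarz inequality\<close>

text \<open>The iterated derivative of \<open>G\<close> at \<open>x\<close> in the directions
  \<open>h i\<close>, \<open>i \<in> S\<close>, expanded over the vertices of the cube; the top
  vertex has sign +1.\<close>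

definition cube_form :: "nat set \<Rightarrow> (('a::ab_group_add) \<Rightarrow> int) \<Rightarrow> 'a \<Rightarrow> (nat \<Rightarrow> 'a) \<Rightarrow> int" where
  "cube_form S G x h = (\<Sum>T\<in>Pow S. (- 1) ^ card (S - T) * G (x + (\<Sum>i\<in>T. h i)))"

lemma cube_form_insert:
  assumes "finite S" "a \<notin> S"
  shows "cube_form (insert a S) G x h = cube_form S (fdiff (h a) G) x h"
proof -
  have "cube_form (insert a S) G x h
      = (\<Sum>T\<in>Pow S. (- 1) ^ card (insert a S - T) * G (x + sum h T))
      + (\<Sum>T\<in>Pow S. (- 1) ^ card (insert a S - insert a T) * G (x + sum h (insert a T)))"
  proof -
    have "inj_on (insert a) (Pow S)"
      using assms(2) by (auto simp: inj_on_def)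
    moreover have "Pow S \<inter> insert a ` Pow S = {}"
      using assms(2) by auto
    ultimately show ?thesis
      using assms(1) unfolding cube_form_def Pow_insert
      by (simp add: sum.union_disjoint sum.reindex)
  qed
  also have "\<dots> = (\<Sum>T\<in>Pow S. (- 1) ^ card (S - T) * (G (x + sum h T + h a) - G (x + sum h T)))"
    unfolding sum.distrib[symmetric]
  proof (intro sum.cong refl)
    fix T assume "T \<in> Pow S"
    then have T: "T \<subseteq> S" "finite T" "a \<notin> T"
      using assms finite_subset by auto
    then have "insert a S - T = insert a (S - T)" "insert a S - insert a T = S - T"
      using assms(2) by auto
    then show "(- 1) ^ card (insert a S - T) * G (x + sum h T)
        + (- 1) ^ card (insert a S - insert a T) * G (x + sum h (insert a T))
        = (- 1) ^ card (S - T) * (G (x + sum h T + h a) - G (x + sum h T))"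
      using assms T by (simp add: algebra_simps)
  qed
  finally show ?thesis
    by (simp add: cube_form_def fdiff_def)
qed

lemma cube_form_cong: "(\<And>i. i \<in> S \<Longrightarrow> h i = h' i) \<Longrightarrow> cube_form S G x h = cube_form S G x h'"
  unfolding cube_form_def by (intro sum.cong refl) (metis PowD subsetD sum.cong)

lemma cube_form_vanish:
  "finite S \<Longrightarrow> deg_less p (card S) G \<Longrightarrow> [cube_form S G x h = 0] (mod int p)"
proof (induction S arbitrary: G rule: finite_induct)
  case empty
  then show ?case
    by (simp add: cube_form_def)
next
  case (insert a S)
  then show ?case
    by (simp add: cube_form_insert)
qed

lemma cube_form_split_top:
  assumes "finite S"
  shows "cube_form S G x h = G (x + sum h S) + (\<Sum>T\<in>Pow S - {S}. (- 1) ^ card (S - T) * G (x + sum h T))"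
  unfolding cube_form_def using assms by (subst sum.remove[of _ S]) auto

lemma cube_form_split_bottom:
  assumes "finite S"
  shows "cube_form S G x h = (- 1) ^ card S * G x
    + (\<Sum>T\<in>Pow S - {{}}. (- 1) ^ card (S - T) * G (x + sum h T))"
  unfolding cube_form_def using assms by (subst sum.remove[of _ "{}"]) auto

lemma periodic_fdiff_direction: "periodic p n G \<Longrightarrow> periodic p n (\<lambda>w. fdiff w G)"
  unfolding periodic_def fdiff_def fun_eq_iff by (simp add: cong_add)

lemma mean_differences:
  assumes "p > 0" "periodic p n K"
  shows "mean (vecs p n) (\<lambda>v. mean (vecs p n) (\<lambda>v'. K (v' - v))) = mean (vecs p n) K"
  using mean_shift[OF assms, of "- v" for v] assms(1) by (simp add: mean_const)

text \<open>One direction \<open>a\<close> is removed at a time. The factor \<open>b a\<close>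
  ignores \<open>y a\<close>, so the triangle inequality discards it; Cauchy-Schwarz doubles the
  variable \<open>y a\<close> into \<open>v\<close> and \<open>v'\<close>, replaces \<open>G\<close>
  by its difference in direction \<open>v' - v\<close>, and leaves factors of the same kind. The
  right-hand side is the Gowers uniformity (semi)norm of \<open>G\<close> to the power
  \<open>2 ^ card S\<close>. The induction starts with one direction: with none, the left-hand side
  is 1 and the inequality fails in general.\<close>

lemma gowers_cauchy_schwarz:
  fixes G :: "(nat \<Rightarrow> int) \<Rightarrow> int" and b :: "nat \<Rightarrow> (nat \<Rightarrow> nat \<Rightarrow> int) \<Rightarrow> complex"
  assumes p: "p > 0" and S: "finite S" "S \<noteq> {}"
  shows "\<lbrakk>periodic p n G; \<And>i y. i \<in> S \<Longrightarrow> norm (b i y) \<le> 1;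
      \<And>i y v. i \<in> S \<Longrightarrow> b i (y(i := v)) = b i y\<rbrakk>
    \<Longrightarrow> norm (mean (S \<rightarrow>\<^sub>E vecs p n) (\<lambda>y. add_char p (G (u + (\<Sum>i\<in>S. y i))) * (\<Prod>i\<in>S. b i y))) ^ 2 ^ card S
      \<le> Re (mean (S \<rightarrow>\<^sub>E vecs p n) (\<lambda>h. mean (vecs p n) (\<lambda>x. add_char p (cube_form S G x h))))"
  using S
proof (induction S arbitrary: G b u rule: finite_ne_induct)
  case (singleton a)
  let ?B = "vecs p n" and ?e = "\<lambda>x. add_char p (G x)"
  define c where "c = b a (\<lambda>_. undefined)"
  have c: "b a ((\<lambda>_. undefined)(a := v)) = c" for v
    unfolding c_def by (rule singleton.prems(3)) simp
  have c1: "norm c \<le> 1"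
    unfolding c_def by (rule singleton.prems(2)) simp
  have pe: "periodic p n ?e"
    by (rule periodic_comp[OF singleton.prems(1)])
  have "mean ({a} \<rightarrow>\<^sub>E ?B) (\<lambda>y. ?e (u + (\<Sum>i\<in>{a}. y i)) * (\<Prod>i\<in>{a}. b i y)) = mean ?B (\<lambda>v. ?e (v + u) * c)"
    by (simp add: mean_PiE_insert mean_singleton c del: fun_upd_apply) (simp add: add.commute)
  also have "\<dots> = mean ?B ?e * c"
    by (simp add: mean_mult_right mean_shift[OF p pe])
  finally have "norm (mean ({a} \<rightarrow>\<^sub>E ?B) (\<lambda>y. ?e (u + (\<Sum>i\<in>{a}. y i)) * (\<Prod>i\<in>{a}. b i y)))
      \<le> norm (mean ?B ?e)"
    using c1 by (simp add: norm_mult mult_left_le)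
  then have "norm (mean ({a} \<rightarrow>\<^sub>E ?B) (\<lambda>y. ?e (u + (\<Sum>i\<in>{a}. y i)) * (\<Prod>i\<in>{a}. b i y))) ^ 2 ^ card {a}
      \<le> (norm (mean ?B ?e))\<^sup>2"
    by (simp add: power_mono)
  also have "of_real ((norm (mean ?B ?e))\<^sup>2) = mean ?B (\<lambda>x. mean ?B (\<lambda>v. ?e (v + x) * cnj (?e x)))"
    unfolding norm_mean_square mean_mult_right mean_shift[OF p pe] ..
  then have "(norm (mean ?B ?e))\<^sup>2 = Re (mean ?B (\<lambda>x. mean ?B (\<lambda>v. ?e (v + x) * cnj (?e x))))"
    by (metis Re_complex_of_real)
  also have "\<dots> = Re (mean ?B (\<lambda>v. mean ?B (\<lambda>x. add_char p (fdiff v G x))))"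
    by (subst mean_swap) (simp add: fdiff_def add_char_diff add.commute)
  also have "mean ?B (\<lambda>v. mean ?B (\<lambda>x. add_char p (fdiff v G x)))
      = mean ({a} \<rightarrow>\<^sub>E ?B) (\<lambda>h. mean ?B (\<lambda>x. add_char p (cube_form {a} G x h)))"
    by (simp add: mean_PiE_insert mean_singleton cube_form_insert) (simp add: cube_form_def)
  finally show ?case .
next
  case (insert a S)
  let ?B = "vecs p n"
  have B: "finite ?B" "?B \<noteq> {}" "finite (S \<rightarrow>\<^sub>E ?B)" "S \<rightarrow>\<^sub>E ?B \<noteq> {}"
    using p insert.hyps by (auto simp: finite_PiE PiE_eq_empty_iff)
  define \<Psi> where "\<Psi> y = add_char p (G (u + (\<Sum>i\<in>insert a S. y i))) * (\<Prod>i\<in>insert a S. b i y)" for y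
  \<comment> \<open>The integrand at \<open>y a = v\<close>, without the factor
    \<open>b a\<close>.\<close>
  define W where "W y v = add_char p (G (u + v + (\<Sum>i\<in>S. y i))) * (\<Prod>i\<in>S. b i (y(a := v)))" for y v
  define X where "X v v' = mean (S \<rightarrow>\<^sub>E ?B) (\<lambda>y. W y v' * cnj (W y v))" for v v'
  have \<Psi>: "\<Psi> (y(a := v)) = b a y * W y v" for y v
  proof -
    have "(\<Sum>i\<in>S. (y(a := v)) i) = (\<Sum>i\<in>S. y i)"
      using insert.hyps by (intro sum.cong) auto
    then show ?thesis
      using insert.hyps insert.prems(3)[of a y v] by (simp add: \<Psi>_def W_def add.assoc del: fun_upd_apply)
        (simp add: mult_ac)
  qed
  have "norm (mean (insert a S \<rightarrow>\<^sub>E ?B) \<Psi>) = norm (mean (S \<rightarrow>\<^sub>E ?B) (\<lambda>y. b a y * mean ?B (W y)))"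
    using insert.hyps by (simp add: mean_PiE_insert \<Psi> mean_mult_left[symmetric] mean_swap[of ?B])
  also have "\<dots> \<le> mean (S \<rightarrow>\<^sub>E ?B) (\<lambda>y. norm (b a y * mean ?B (W y)))"
    by (rule norm_mean_le)
  also have "\<dots> \<le> mean (S \<rightarrow>\<^sub>E ?B) (\<lambda>y. norm (mean ?B (W y)))"
    using insert.prems(2)[of a] by (intro mean_mono) (simp add: norm_mult mult_left_le_one_le)
  finally have "(norm (mean (insert a S \<rightarrow>\<^sub>E ?B) \<Psi>))\<^sup>2 \<le> (mean (S \<rightarrow>\<^sub>E ?B) (\<lambda>y. norm (mean ?B (W y))))\<^sup>2"
    by (intro power_mono) auto
  also have "\<dots> \<le> mean (S \<rightarrow>\<^sub>E ?B) (\<lambda>y. (norm (mean ?B (W y)))\<^sup>2)"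
    by (rule mean_square_le[OF B(3,4)])
  also have "\<dots> \<le> mean ?B (\<lambda>v. mean ?B (\<lambda>v'. norm (X v v')))"
  proof -
    let ?m = "mean (S \<rightarrow>\<^sub>E ?B) (\<lambda>y. (norm (mean ?B (W y)))\<^sup>2)"
    have "of_real ?m = mean (S \<rightarrow>\<^sub>E ?B) (\<lambda>y. mean ?B (\<lambda>v. mean ?B (\<lambda>v'. W y v' * cnj (W y v))))"
      by (simp only: mean_of_real[symmetric] norm_mean_square)
    also have "\<dots> = mean ?B (\<lambda>v. mean (S \<rightarrow>\<^sub>E ?B) (\<lambda>y. mean ?B (\<lambda>v'. W y v' * cnj (W y v))))"
      by (rule mean_swap)
    also have "\<dots> = mean ?B (\<lambda>v. mean ?B (X v))"
      unfolding X_def[abs_def] by (rule mean_cong, rule mean_swap)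
    finally have "norm (of_real ?m :: complex) = norm (mean ?B (\<lambda>v. mean ?B (X v)))"
      by (rule arg_cong)
    then have "?m \<le> norm (mean ?B (\<lambda>v. mean ?B (X v)))"
      by simp
    also have "\<dots> \<le> mean ?B (\<lambda>v. norm (mean ?B (X v)))"
      by (rule norm_mean_le)
    also have "\<dots> \<le> mean ?B (\<lambda>v. mean ?B (\<lambda>v'. norm (X v v')))"
      by (intro mean_mono norm_mean_le)
    finally show ?thesis .
  qed
  finally have "norm (mean (insert a S \<rightarrow>\<^sub>E ?B) \<Psi>) ^ 2 ^ card (insert a S)
      \<le> mean ?B (\<lambda>v. mean ?B (\<lambda>v'. norm (X v v'))) ^ 2 ^ card S"
    using insert.hyps by (simp add: power_mult power_mono)
  \<comment> \<open>The power is moved inside both means, so that the induction hypothesis can be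
    applied to each pair \<open>v\<close>, \<open>v'\<close> separately.\<close>
  also have "\<dots> \<le> mean ?B (\<lambda>v. mean ?B (\<lambda>v'. norm (X v v')) ^ 2 ^ card S)"
    by (intro mean_power_le B mean_nonneg) simp
  also have "\<dots> \<le> mean ?B (\<lambda>v. mean ?B (\<lambda>v'. norm (X v v') ^ 2 ^ card S))"
    by (intro mean_mono mean_power_le B) simp
  also have "\<dots> \<le> mean ?B (\<lambda>v. mean ?B (\<lambda>v'. Re (mean (S \<rightarrow>\<^sub>E ?B)
      (\<lambda>h. mean ?B (\<lambda>x. add_char p (cube_form S (fdiff (v' - v) G) x h))))))"
  proof (intro mean_mono)
    fix v v'
    let ?b = "\<lambda>i y. b i (y(a := v')) * cnj (b i (y(a := v)))"
    have "W y v' * cnj (W y v)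
        = add_char p (fdiff (v' - v) G (u + v + (\<Sum>i\<in>S. y i))) * (\<Prod>i\<in>S. ?b i y)" for y
      by (simp add: W_def fdiff_def add_char_diff prod.distrib algebra_simps)
    moreover have "norm (mean (S \<rightarrow>\<^sub>E ?B) (\<lambda>y. add_char p (fdiff (v' - v) G (u + v + (\<Sum>i\<in>S. y i)))
        * (\<Prod>i\<in>S. ?b i y))) ^ 2 ^ card S
      \<le> Re (mean (S \<rightarrow>\<^sub>E ?B) (\<lambda>h. mean ?B (\<lambda>x. add_char p (cube_form S (fdiff (v' - v) G) x h))))"
    proof (rule insert.IH)
      show "periodic p n (fdiff (v' - v) G)"
        by (rule periodic_fdiff[OF insert.prems(1)])
      show "norm (?b i y) \<le> 1" if "i \<in> S" for i y
        unfolding norm_mult complex_mod_cnj using that insert.prems(2) by (intro mult_le_one) auto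
      show "?b i (y(i := w)) = ?b i y" if "i \<in> S" for i y w
      proof -
        have "a \<noteq> i"
          using that insert.hyps by blast
        then show ?thesis
          using insert.prems(3)[of i] that by (simp add: fun_upd_twist[of i a] del: fun_upd_apply)
      qed
    qed
    ultimately show "norm (X v v') ^ 2 ^ card S \<le> Re (mean (S \<rightarrow>\<^sub>E ?B)
        (\<lambda>h. mean ?B (\<lambda>x. add_char p (cube_form S (fdiff (v' - v) G) x h))))"
      unfolding X_def by (simp only:)
  qed
  \<comment> \<open>The difference of two independent uniform vectors is uniform and becomes the new
    direction \<open>h a\<close> of the larger cube.\<close>
  also have "\<dots> = mean ?B (\<lambda>w. Re (mean (S \<rightarrow>\<^sub>E ?B)
      (\<lambda>h. mean ?B (\<lambda>x. add_char p (cube_form S (fdiff w G) x h)))))"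
    by (rule mean_differences[OF p periodic_comp[OF periodic_fdiff_direction[OF insert.prems(1)],
      where \<phi> = "\<lambda>H. Re (mean (S \<rightarrow>\<^sub>E ?B) (\<lambda>h. mean ?B (\<lambda>x. add_char p (cube_form S H x h))))"]])
  also have "\<dots> = Re (mean (insert a S \<rightarrow>\<^sub>E ?B) (\<lambda>h. mean ?B (\<lambda>x. add_char p (cube_form (insert a S) G x h))))"
  proof -
    have "cube_form (insert a S) G x (h(a := w)) = cube_form S (fdiff w G) x h" for x h w
    proof -
      have "cube_form S (fdiff w G) x (h(a := w)) = cube_form S (fdiff w G) x h"
        using insert.hyps by (intro cube_form_cong) auto
      then show ?thesis
        using insert.hyps by (simp add: cube_form_insert)
    qed
    then show ?thesis
      using insert.hyps by (simp add: mean_PiE_insert mean_Re)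
  qed
  finally show ?case
    unfolding \<Psi>_def .
qed

section \<open>Encoding tuples of vectors as vectors\<close>

text \<open>\<open>L\<close> vectors are interleaved into one, coordinate \<open>i\<close> of the
  \<open>l\<close>-th being stored at \<open>i * L + l\<close>; decoding is division with remainder
  by \<open>L\<close>, and the first \<open>n\<close> coordinates of all components fill exactly the
  first \<open>n * L\<close> places.\<close>

definition component :: "nat \<Rightarrow> nat \<Rightarrow> (nat \<Rightarrow> int) \<Rightarrow> (nat \<Rightarrow> int)" where
  "component L l z = (\<lambda>i. z (i * L + l))"

lemma component_add: "component L l (z + w) = component L l z + component L l w"
  by (simp add: component_def fun_eq_iff)

lemma component_surj: "\<exists>z. \<forall>l<L. component L l z = y l"
  by (rule exI[of _ "\<lambda>j. y (j mod L) (j div L)"]) (simp add: component_def)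

lemma index_less_iff:
  fixes i l n L :: nat
  assumes l: "l < L"
  shows "i * L + l < n * L \<longleftrightarrow> i < n"
proof
  assume "i * L + l < n * L"
  then show "i < n"
    by (metis add_lessD1 mult_less_cancel2)
next
  assume "i < n"
  from l have "i * L + l < Suc i * L"
    by simp
  also have "\<dots> \<le> n * L"
    using \<open>i < n\<close> by (intro mult_le_mono1) simp
  finally show "i * L + l < n * L" .
qed

lemma component_in_vecs:
  assumes "z \<in> vecs p (n * L)" "l < L"
  shows "component L l z \<in> vecs p n"
  unfolding vecs_def
proof (rule PiE_I)
  fix i assume "i \<in> {..<n}"
  then have "i * L + l \<in> {..<n * L}"
    using index_less_iff[OF assms(2)] by simp
  then show "component L l z i \<in> Fp p"
    using assms(1) unfolding vecs_def component_def by blast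
next
  fix i assume "i \<notin> {..<n}"
  then have "i * L + l \<notin> {..<n * L}"
    using index_less_iff[OF assms(2)] by simp
  then show "component L l z i = undefined"
    using assms(1) unfolding vecs_def component_def by blast
qed

lemma mean_components:
  assumes "L > 0"
  shows "mean (vecs p (n * L)) (\<lambda>z. F (\<lambda>l\<in>{..<L}. component L l z)) = mean ({..<L} \<rightarrow>\<^sub>E vecs p n) F"
proof (rule mean_reindex)
  let ?g = "\<lambda>y j. if j < n * L then y (j mod L) (j div L) else undefined"
  show "bij_betw (\<lambda>z. \<lambda>l\<in>{..<L}. component L l z) (vecs p (n * L)) ({..<L} \<rightarrow>\<^sub>E vecs p n)"
  proof (rule bij_betw_byWitness[where f' = ?g])
    show "\<forall>z\<in>vecs p (n * L). ?g (\<lambda>l\<in>{..<L}. component L l z) = z"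
      using assms by (auto simp: vecs_def component_def fun_eq_iff PiE_iff extensional_def)
    show "\<forall>y\<in>{..<L} \<rightarrow>\<^sub>E vecs p n. (\<lambda>l\<in>{..<L}. component L l (?g y)) = y"
    proof (rule ballI, rule ext)
      fix y l assume y: "y \<in> {..<L} \<rightarrow>\<^sub>E vecs p n"
      show "(\<lambda>l\<in>{..<L}. component L l (?g y)) l = y l"
      proof (cases "l < L")
        case True
        then have "y l \<in> vecs p n"
          using y by auto
        then show ?thesis
          using True by (auto simp: component_def index_less_iff fun_eq_iff vecs_def PiE_iff extensional_def)
      next
        case False
        then show ?thesis
          using y by (auto simp: PiE_iff extensional_def)
      qed
    qed
    show "(\<lambda>z. \<lambda>l\<in>{..<L}. component L l z) ` vecs p (n * L) \<subseteq> {..<L} \<rightarrow>\<^sub>E vecs p n"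
      by (intro image_subsetI) (simp add: restrict_PiE_iff component_in_vecs)
    show "?g ` ({..<L} \<rightarrow>\<^sub>E vecs p n) \<subseteq> vecs p (n * L)"
    proof (rule image_subsetI)
      fix y assume y: "y \<in> {..<L} \<rightarrow>\<^sub>E vecs p n"
      have mem: "y (j mod L) (j div L) \<in> Fp p" if "j < n * L" for j
      proof -
        have "y (j mod L) \<in> vecs p n"
          using y assms by (intro PiE_mem[OF y]) simp
        moreover have "j div L \<in> {..<n}"
          using that by (simp add: less_mult_imp_div_less)
        ultimately show ?thesis
          unfolding vecs_def by (rule PiE_mem)
      qed
      show "?g y \<in> vecs p (n * L)"
        unfolding vecs_def by (rule PiE_I) (use mem in auto)
    qed
  qed
qed

section \<open>Biased functions of bounded degree are structured\<close>

definition determined_by :: "nat \<Rightarrow> (('a::ab_group_add) \<Rightarrow> int) \<Rightarrow> 'a set \<Rightarrow> bool" where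
  "determined_by p f H \<longleftrightarrow>
    (\<forall>x x'. (\<forall>h\<in>H. [fdiff h f x = fdiff h f x'] (mod int p)) \<longrightarrow> [f x = f x'] (mod int p))"

text \<open>\<open>c\<close> is fixed before the prime and the dimension. The freedom in the
  dimension is used by the induction: the constant of a lower degree is applied to functions of
  several vectors, encoded in a larger space.\<close>

definition structured :: "nat \<Rightarrow> nat \<Rightarrow> nat \<Rightarrow> bool" where
  "structured k s c \<longleftrightarrow> (\<forall>p n (f :: (nat \<Rightarrow> int) \<Rightarrow> int).
     prime p \<longrightarrow> periodic p n f \<longrightarrow> deg_less p k f \<longrightarrow>
     1 / real p ^ s \<le> norm (mean (vecs p n) (\<lambda>x. add_char p (f x))) \<longrightarrow>
     (\<exists>H. finite H \<and> card H \<le> c \<and> determined_by p f H))"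

text \<open>The cube form is a biased function of the base point and the directions jointly. A
  direction in this larger space moves every vertex by its own amount, which is why the elements of
  \<open>W\<close> assign a direction of the original space to each vertex.\<close>

lemma cube_form_determined:
  fixes G :: "(nat \<Rightarrow> int) \<Rightarrow> int"
  assumes struct: "structured j s c" and p: "prime p"
    and G: "periodic p n G" "deg_less p j G" and S: "S \<subseteq> {..<D}"
    and bias: "1 / real p ^ s
      \<le> norm (mean (S \<rightarrow>\<^sub>E vecs p n) (\<lambda>h. mean (vecs p n) (\<lambda>x. add_char p (cube_form S G x h))))"
  shows "\<exists>W :: (nat set \<Rightarrow> nat \<Rightarrow> int) set. finite W \<and> card W \<le> c \<and> (\<forall>x h x' h'.
    (\<forall>\<delta>\<in>W. \<forall>T\<subseteq>S. [fdiff (\<delta> T) G (x + sum h T) = fdiff (\<delta> T) G (x' + sum h' T)] (mod int p)) \<longrightarrow>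
    [cube_form S G x h = cube_form S G x' h'] (mod int p))"
proof -
  \<comment> \<open>Components below \<open>D\<close> are the directions of the cube; the extra
    component \<open>D\<close> is its base point.\<close>
  let ?B = "vecs p n" and ?L = "Suc D"
  let ?c = "component ?L"
  define P where "P z = cube_form S G (?c D z) (\<lambda>i. ?c i z)" for z
  have p0: "p > 0"
    using p by (simp add: prime_gt_0_nat)
  have B: "finite ?B" "?B \<noteq> {}"
    using p0 by auto
  have hom: "?c D (z + w) + (\<Sum>i\<in>T. ?c i (z + w)) = (?c D z + (\<Sum>i\<in>T. ?c i z)) + (?c D w + (\<Sum>i\<in>T. ?c i w))"
    for z w T by (simp add: component_add sum.distrib algebra_simps)
  have finS: "finite S"
    using S finite_subset by blast
  have per: "periodic p (n * ?L) P"
    unfolding periodic_def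
  proof (intro allI impI)
    fix z w assume zw: "\<forall>i<n * ?L. [z i = w i] (mod int p)"
    have c: "[?c l z i = ?c l w i] (mod int p)" if "i < n" "l < ?L" for l i
      unfolding component_def using zw index_less_iff[OF that(2), of i n] that by simp
    have "G (?c D z + (\<Sum>i\<in>T. ?c i z)) = G (?c D w + (\<Sum>i\<in>T. ?c i w))" if "T \<subseteq> S" for T
    proof (rule periodicD[OF G(1)])
      fix i assume i: "i < n"
      have sum_app: "(\<Sum>l\<in>T. ?c l v) i = (\<Sum>l\<in>T. ?c l v i)" for v
        by (induction T rule: infinite_finite_induct) auto
      have "[(\<Sum>l\<in>T. ?c l z i) = (\<Sum>l\<in>T. ?c l w i)] (mod int p)"
        using that S by (intro cong_sum c[OF i]) auto
      then show "[(?c D z + (\<Sum>l\<in>T. ?c l z)) i = (?c D w + (\<Sum>l\<in>T. ?c l w)) i] (mod int p)"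
        by (simp add: sum_app cong_add c[OF i])
    qed
    then show "P z = P w"
      unfolding P_def cube_form_def by (intro sum.cong refl) auto
  qed
  have deg: "deg_less p j P"
    unfolding P_def cube_form_def
    by (intro deg_less_sum deg_less_hom[where \<phi> = "\<lambda>z. ?c D z + (\<Sum>i\<in>T. ?c i z)" for T, OF hom G(2)])
  have "mean (vecs p (n * ?L)) (\<lambda>z. add_char p (P z))
      = mean (vecs p (n * ?L)) (\<lambda>z. (\<lambda>y. add_char p (cube_form S G (y D) y)) (\<lambda>l\<in>{..<?L}. ?c l z))"
    unfolding P_def using S by (intro mean_cong arg_cong[where f = "add_char p"]) (auto intro!: cube_form_cong)
  also have "\<dots> = mean ({..<?L} \<rightarrow>\<^sub>E ?B) (\<lambda>y. add_char p (cube_form S G (y D) y))"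
    by (rule mean_components) simp
  also have "\<dots> = mean ?B (\<lambda>x. mean ({..<D} \<rightarrow>\<^sub>E ?B) (\<lambda>h. add_char p (cube_form S G x h)))"
  proof -
    have "cube_form S G x (y(D := v)) = cube_form S G x y" for x y v
      using S by (intro cube_form_cong) auto
    then show ?thesis
      unfolding lessThan_Suc by (subst mean_PiE_insert) auto
  qed
  also have "\<dots> = mean ?B (\<lambda>x. mean (S \<rightarrow>\<^sub>E ?B) (\<lambda>h. add_char p (cube_form S G x h)))"
  proof (rule mean_cong)
    fix x
    have "cube_form S G x (y(a := v)) = cube_form S G x y" if "a \<notin> S" for y a v
      using that by (intro cube_form_cong) auto
    then show "mean ({..<D} \<rightarrow>\<^sub>E ?B) (\<lambda>h. add_char p (cube_form S G x h))
        = mean (S \<rightarrow>\<^sub>E ?B) (\<lambda>h. add_char p (cube_form S G x h))"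
      using mean_PiE_superset[of "{..<D} - S" ?B S "\<lambda>h. add_char p (cube_form S G x h)"] B S
      by (simp add: Un_absorb2 Int_commute)
  qed
  also have "\<dots> = mean (S \<rightarrow>\<^sub>E ?B) (\<lambda>h. mean ?B (\<lambda>x. add_char p (cube_form S G x h)))"
    by (rule mean_swap)
  finally obtain H where H: "finite H" "card H \<le> c" "determined_by p P H"
    using struct p per deg bias unfolding structured_def by metis
  \<comment> \<open>The displacement of the vertex \<open>T\<close> when base point and directions
    all move by the components of \<open>w\<close>.\<close>
  define dir where "dir w T = ?c D w + (\<Sum>i\<in>T. ?c i w)" for w T
  have diff: "fdiff w P z = (\<Sum>T\<in>Pow S. (- 1) ^ card (S - T) * fdiff (dir w T) G (?c D z + (\<Sum>i\<in>T. ?c i z)))"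
    for w z
    unfolding fdiff_def P_def cube_form_def hom dir_def by (simp add: sum_subtractf right_diff_distrib)
  show ?thesis
  proof (intro exI[of _ "dir ` H"] conjI allI impI)
    show "finite (dir ` H)"
      using H(1) by simp
    show "card (dir ` H) \<le> c"
      using card_image_le[OF H(1)] H(2) le_trans by blast
    fix x h x' h'
    assume eq: "\<forall>\<delta>\<in>dir ` H. \<forall>T\<subseteq>S.
      [fdiff (\<delta> T) G (x + sum h T) = fdiff (\<delta> T) G (x' + sum h' T)] (mod int p)"
    obtain z where z: "\<forall>l<?L. ?c l z = (h(D := x)) l"
      using component_surj by blast
    obtain z' where z': "\<forall>l<?L. ?c l z' = (h'(D := x')) l"
      using component_surj by blast
    have zs: "?c D z = x" "?c D z' = x'" "\<And>i. i \<in> S \<Longrightarrow> ?c i z = h i" "\<And>i. i \<in> S \<Longrightarrow> ?c i z' = h' i"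
      using z z' S by auto
    have sums: "(\<Sum>i\<in>T. ?c i z) = sum h T" "(\<Sum>i\<in>T. ?c i z') = sum h' T" if "T \<subseteq> S" for T
      using zs that by (auto intro!: sum.cong)
    have "[fdiff w P z = fdiff w P z'] (mod int p)" if "w \<in> H" for w
      unfolding diff zs using eq that by (intro cong_sum cong_scalar_left) (auto simp: sums)
    then have "[P z = P z'] (mod int p)"
      using H(3) unfolding determined_by_def by blast
    moreover have "P z = cube_form S G x h" "P z' = cube_form S G x' h'"
      unfolding P_def zs using zs by (auto intro!: cube_form_cong)
    ultimately show "[cube_form S G x h = cube_form S G x' h'] (mod int p)"
      by simp
  qed
qed

section \<open>Equidistribution\<close>

text \<open>The indicator of the fibre is expanded in characters. The trivial one contributes
  \<open>card Y\<close>; the others, fewer than \<open>p ^ card I\<close>, contribute together at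
  most \<open>card Y / p ^ 2\<close>, hence at most a quarter of \<open>card Y\<close>. This
  explains the exponent \<open>card I + 2\<close> and the factor 5/4.\<close>

lemma card_fibre_le:
  fixes \<Phi> :: "'y \<Rightarrow> 'i \<Rightarrow> int"
  assumes p: "prime p" and I: "finite I" and Y: "finite Y" "Y \<noteq> {}"
    and small: "\<And>\<alpha>. \<lbrakk>\<alpha> \<in> I \<rightarrow>\<^sub>E {..<p}; \<exists>i\<in>I. \<alpha> i \<noteq> 0\<rbrakk>
      \<Longrightarrow> norm (mean Y (\<lambda>y. add_char p (\<Sum>i\<in>I. int (\<alpha> i) * \<Phi> y i))) \<le> 1 / real p ^ (card I + 2)"
  shows "4 * p ^ card I * card {y \<in> Y. \<forall>i\<in>I. [\<Phi> y i = v i] (mod int p)} \<le> 5 * card Y"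
proof -
  let ?m = "card I" and ?F = "{y \<in> Y. \<forall>i\<in>I. [\<Phi> y i = v i] (mod int p)}" and ?\<Lambda> = "I \<rightarrow>\<^sub>E {..<p}"
  have p0: "p > 0" and p2: "p \<ge> 2"
    using p by (simp_all add: prime_gt_0_nat prime_ge_2_nat)
  let ?z = "\<lambda>i\<in>I. 0 :: nat"
  have z: "?z \<in> ?\<Lambda>"
    using p0 by auto
  have fin: "finite ?\<Lambda>"
    using I by (simp add: finite_PiE)
  have card\<Lambda>: "card ?\<Lambda> = p ^ ?m"
    using I by (simp add: card_PiE)
  let ?T = "\<lambda>\<alpha>. \<Sum>y\<in>Y. add_char p (\<Sum>i\<in>I. int (\<alpha> i) * (\<Phi> y i - v i))"
  have ind: "(\<Prod>i\<in>I. \<Sum>l<p. add_char p (int l * (\<Phi> y i - v i)))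
      = (if \<forall>i\<in>I. [\<Phi> y i = v i] (mod int p) then of_nat (p ^ ?m) else 0)" for y
    using I p0 by (auto simp: sum_add_char[OF p0] cong_iff_dvd_diff)
  have "of_nat (p ^ ?m * card ?F) = (\<Sum>y\<in>Y. \<Prod>i\<in>I. \<Sum>l<p. add_char p (int l * (\<Phi> y i - v i)))"
    unfolding ind using Y by (simp add: sum.If_cases Int_def mult.commute)
  also have "\<dots> = (\<Sum>\<alpha>\<in>?\<Lambda>. ?T \<alpha>)"
    using I by (subst sum.swap) (simp add: prod_sum_PiE add_char_sum)
  also have "\<dots> = ?T ?z + (\<Sum>\<alpha>\<in>?\<Lambda> - {?z}. ?T \<alpha>)"
    by (rule sum.remove[OF fin z])
  also have "?T ?z = of_nat (card Y)"
  proof -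
    have "(\<Sum>i\<in>I. int (?z i) * (\<Phi> y i - v i)) = 0" for y
      by (intro sum.neutral) simp
    then show ?thesis
      by (simp only: add_char_0 sum_constant mult_1_right)
  qed
  finally have total: "of_nat (p ^ ?m * card ?F) = (of_nat (card Y) + (\<Sum>\<alpha>\<in>?\<Lambda> - {?z}. ?T \<alpha>) :: complex)" .
  have "real (p ^ ?m * card ?F) = norm (of_nat (p ^ ?m * card ?F) :: complex)"
    by (rule norm_of_nat[symmetric])
  also note total
  also have "norm (of_nat (card Y) + (\<Sum>\<alpha>\<in>?\<Lambda> - {?z}. ?T \<alpha>))
      \<le> norm (of_nat (card Y) :: complex) + norm (\<Sum>\<alpha>\<in>?\<Lambda> - {?z}. ?T \<alpha>)"
    by (rule norm_triangle_ineq)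
  also have "norm (\<Sum>\<alpha>\<in>?\<Lambda> - {?z}. ?T \<alpha>) \<le> (\<Sum>\<alpha>\<in>?\<Lambda> - {?z}. real (card Y) / real p ^ (?m + 2))"
  proof (rule sum_norm_le)
    fix \<alpha> assume \<alpha>: "\<alpha> \<in> ?\<Lambda> - {?z}"
    then have "\<exists>i\<in>I. \<alpha> i \<noteq> 0"
      by (auto simp: PiE_iff extensional_def fun_eq_iff restrict_def split: if_splits)
    then have s: "norm (mean Y (\<lambda>y. add_char p (\<Sum>i\<in>I. int (\<alpha> i) * \<Phi> y i))) \<le> 1 / real p ^ (?m + 2)"
      using \<alpha> small by blast
    have "?T \<alpha> = (\<Sum>y\<in>Y. add_char p (\<Sum>i\<in>I. int (\<alpha> i) * \<Phi> y i)) * cnj (add_char p (\<Sum>i\<in>I. int (\<alpha> i) * v i))"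
      by (simp add: sum_distrib_right add_char_diff[symmetric] right_diff_distrib sum_subtractf)
    then have "norm (?T \<alpha>) = norm (mean Y (\<lambda>y. add_char p (\<Sum>i\<in>I. int (\<alpha> i) * \<Phi> y i))) * card Y"
      using Y by (simp add: norm_mult mean_def norm_divide)
    also have "\<dots> \<le> 1 / real p ^ (?m + 2) * card Y"
      by (intro mult_right_mono s) simp
    finally show "norm (?T \<alpha>) \<le> real (card Y) / real p ^ (?m + 2)"
      by simp
  qed
  also have "\<dots> \<le> real (card Y) / 4"
  proof -
    have "card (?\<Lambda> - {?z}) \<le> p ^ ?m"
      using card_mono[OF fin, of "?\<Lambda> - {?z}"] card\<Lambda> by auto
    then have "real (card (?\<Lambda> - {?z})) * (real (card Y) / real p ^ (?m + 2))
        \<le> real (p ^ ?m) * (real (card Y) / real p ^ (?m + 2))"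
      by (intro mult_right_mono of_nat_mono) auto
    also have "\<dots> = real (card Y) / (real p)\<^sup>2"
      using p0 by (simp add: power_add power2_eq_square)
    also have "\<dots> \<le> real (card Y) / 4"
      using power_mono[of 2 "real p" 2] p2 by (intro divide_left_mono) auto
    finally show ?thesis
      by simp
  qed
  finally have "real (4 * p ^ ?m * card ?F) \<le> real (5 * card Y)"
    by simp
  then show ?thesis
    unfolding of_nat_le_iff .
qed

text \<open>A set of density 3/4 cannot be covered by fewer than 3/5 of \<open>N\<close> fibres if
  each has density at most 5/4 of \<open>1 / N\<close>. Since 3/5 exceeds 1/2, two such images among
  \<open>N\<close> values must meet.\<close>

lemma card_image_ge:
  assumes N: "\<And>v. 4 * N * card {y \<in> Y. \<Psi> y = v} \<le> 5 * card Y"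
    and Y: "finite Y" "Y \<noteq> {}" and A: "A \<subseteq> Y" "3 * card Y \<le> 4 * card A"
  shows "3 * N \<le> 5 * card (\<Psi> ` A)"
proof -
  have finA: "finite A"
    using A(1) Y(1) finite_subset by blast
  have "card A = (\<Sum>v\<in>\<Psi> ` A. card {y \<in> A. \<Psi> y = v})"
    using sum.image_gen[OF finA, of "\<lambda>_. 1 :: nat" \<Psi>] by simp
  then have "4 * N * card A = (\<Sum>v\<in>\<Psi> ` A. 4 * N * card {y \<in> A. \<Psi> y = v})"
    by (simp add: sum_distrib_left)
  also have "\<dots> \<le> (\<Sum>v\<in>\<Psi> ` A. 5 * card Y)"
  proof (rule sum_mono)
    fix v
    have "card {y \<in> A. \<Psi> y = v} \<le> card {y \<in> Y. \<Psi> y = v}"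
      using A(1) Y(1) by (intro card_mono) auto
    then show "4 * N * card {y \<in> A. \<Psi> y = v} \<le> 5 * card Y"
      using N[of v] by (meson le_trans mult_le_mono2)
  qed
  finally have "N * (4 * card A) \<le> 5 * card (\<Psi> ` A) * card Y"
    by (simp add: mult_ac)
  with mult_le_mono2[OF A(2), of N] have "N * (3 * card Y) \<le> 5 * card (\<Psi> ` A) * card Y"
    by (rule le_trans)
  then have "3 * N * card Y \<le> 5 * card (\<Psi> ` A) * card Y"
    by (simp add: mult_ac)
  moreover have "card Y > 0"
    using Y by (simp add: card_gt_0_iff)
  ultimately show ?thesis
    by simp
qed

section \<open>Overlapping distributions on cubes\<close>

text \<open>An item \<open>(ws, S)\<close> stands for the function \<open>y \<mapsto> D\<^bsub>ws\<^esub> f (x + \<Sum>\<^bsub>i \<in> S\<^esub> y\<^sub>i)\<close> on the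
  \<open>k\<close>-dimensional cubes based at \<open>x\<close>.\<close>

type_synonym item = "(nat \<Rightarrow> int) list \<times> nat set"

definition item_val :: "((nat \<Rightarrow> int) \<Rightarrow> int) \<Rightarrow> (nat \<Rightarrow> int) \<Rightarrow> (nat \<Rightarrow> nat \<Rightarrow> int) \<Rightarrow> item \<Rightarrow> int" where
  "item_val f x y i = fdiffs (fst i) f (x + sum y (snd i))"

text \<open>At least one difference, so that the degree bound is below that of \<open>f\<close> and
  values at the base point reduce to derivatives of \<open>f\<close>; at most \<open>k\<close>,
  since by then \<open>f\<close> is exhausted. The empty face is the base point itself, where
  agreement is imposed by directions and not by items.\<close>

definition valid :: "nat \<Rightarrow> item \<Rightarrow> bool" where
  "valid k i \<longleftrightarrow> fst i \<noteq> [] \<and> length (fst i) \<le> k \<and> snd i \<noteq> {} \<and> snd i \<subseteq> {..<k}"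

text \<open>A lexicographic order: more differences come lower, and for equally many a smaller face
  does. The weight \<open>k + 1\<close> exceeds the size of any face.\<close>

definition rank :: "nat \<Rightarrow> item \<Rightarrow> nat" where
  "rank k i = (k - length (fst i)) * (k + 1) + card (snd i)"

definition cubes :: "nat \<Rightarrow> nat \<Rightarrow> nat \<Rightarrow> (nat \<Rightarrow> nat \<Rightarrow> int) set" where
  "cubes p n k = {..<k} \<rightarrow>\<^sub>E vecs p n"

text \<open>Allowing arbitrary dense \<open>A\<close> and \<open>A'\<close> makes the notion robust:
  the cubes with good vertices can be inserted at the very end, and \<open>A\<close>,
  \<open>A'\<close> pass unchanged through every trade of items.\<close>

definition overlap :: "nat \<Rightarrow> nat \<Rightarrow> nat \<Rightarrow> ((nat \<Rightarrow> int) \<Rightarrow> int) \<Rightarrow> item set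
    \<Rightarrow> (nat \<Rightarrow> int) \<Rightarrow> (nat \<Rightarrow> int) \<Rightarrow> bool" where
  "overlap p n k f I x x' \<longleftrightarrow> (\<forall>A A'. A \<subseteq> cubes p n k \<longrightarrow> A' \<subseteq> cubes p n k \<longrightarrow>
     3 * card (cubes p n k) \<le> 4 * card A \<longrightarrow> 3 * card (cubes p n k) \<le> 4 * card A' \<longrightarrow>
     (\<exists>y\<in>A. \<exists>y'\<in>A'. \<forall>i\<in>I. [item_val f x y i = item_val f x' y' i] (mod int p)))"

lemma overlapD:
  "\<lbrakk>overlap p n k f I x x'; A \<subseteq> cubes p n k; A' \<subseteq> cubes p n k;
    3 * card (cubes p n k) \<le> 4 * card A; 3 * card (cubes p n k) \<le> 4 * card A'\<rbrakk>
    \<Longrightarrow> \<exists>y\<in>A. \<exists>y'\<in>A'. \<forall>i\<in>I. [item_val f x y i = item_val f x' y' i] (mod int p)"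
  unfolding overlap_def by blast

lemma cubes_finite_nonempty: "p > 0 \<Longrightarrow> finite (cubes p n k) \<and> cubes p n k \<noteq> {}"
  by (auto simp: cubes_def finite_PiE PiE_eq_empty_iff)

text \<open>Both value sets fill at least 3/5 of the \<open>p ^ card I\<close> possible patterns, so
  they intersect.\<close>

lemma overlap_if_equidistributed:
  assumes p: "prime p" and I: "finite I"
    and small: "\<And>x \<alpha>. \<lbrakk>\<alpha> \<in> I \<rightarrow>\<^sub>E {..<p}; \<exists>i\<in>I. \<alpha> i \<noteq> 0\<rbrakk>
      \<Longrightarrow> norm (mean (cubes p n k) (\<lambda>y. add_char p (\<Sum>i\<in>I. int (\<alpha> i) * item_val f x y i)))
        \<le> 1 / real p ^ (card I + 2)"
  shows "overlap p n k f I x x'"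
  unfolding overlap_def
proof (intro allI impI)
  let ?Y = "cubes p n k" and ?N = "p ^ card I"
  fix A A' assume A: "A \<subseteq> ?Y" "3 * card ?Y \<le> 4 * card A" and A': "A' \<subseteq> ?Y" "3 * card ?Y \<le> 4 * card A'"
  have p0: "p > 0"
    using p by (simp add: prime_gt_0_nat)
  note Y = cubes_finite_nonempty[OF p0, of n k, THEN conjunct1] cubes_finite_nonempty[OF p0, of n k, THEN conjunct2]
  define \<Psi> where "\<Psi> x y = (\<lambda>i\<in>I. item_val f x y i mod int p)" for x y
  have fib: "4 * ?N * card {y \<in> ?Y. \<Psi> x y = v} \<le> 5 * card ?Y" for x v
  proof -
    have "{y \<in> ?Y. \<Psi> x y = v} \<subseteq> {y \<in> ?Y. \<forall>i\<in>I. [item_val f x y i = v i] (mod int p)}"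
      by (auto simp: \<Psi>_def cong_def)
    then have "card {y \<in> ?Y. \<Psi> x y = v} \<le> card {y \<in> ?Y. \<forall>i\<in>I. [item_val f x y i = v i] (mod int p)}"
      using Y(1) by (intro card_mono) auto
    moreover have "4 * ?N * card {y \<in> ?Y. \<forall>i\<in>I. [item_val f x y i = v i] (mod int p)} \<le> 5 * card ?Y"
      by (rule card_fibre_le[OF p I Y small])
    ultimately show ?thesis
      by (meson le_trans mult_le_mono2)
  qed
  have "\<Psi> x ` A \<inter> \<Psi> x' ` A' \<noteq> {}"
  proof
    assume disj: "\<Psi> x ` A \<inter> \<Psi> x' ` A' = {}"
    have "finite A" "finite A'"
      using A(1) A'(1) Y(1) finite_subset by blast+
    then have "card (\<Psi> x ` A) + card (\<Psi> x' ` A') = card (\<Psi> x ` A \<union> \<Psi> x' ` A')"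
      using disj by (simp add: card_Un_disjoint)
    also have "\<dots> \<le> card (I \<rightarrow>\<^sub>E {0..<int p})"
      using I p0 by (intro card_mono) (auto simp: \<Psi>_def finite_PiE)
    also have "\<dots> = ?N"
      using I by (simp add: card_PiE)
    finally have "5 * card (\<Psi> x ` A) + 5 * card (\<Psi> x' ` A') \<le> 5 * ?N"
      by simp
    moreover have "3 * ?N \<le> 5 * card (\<Psi> x ` A)" "3 * ?N \<le> 5 * card (\<Psi> x' ` A')"
      using card_image_ge[OF fib Y A] card_image_ge[OF fib Y A'] .
    ultimately have "?N = 0"
      by linarith
    then show False
      using p0 by simp
  qed
  then obtain v where v: "v \<in> \<Psi> x ` A" "v \<in> \<Psi> x' ` A'"
    by (meson ex_in_conv IntE)
  obtain y where y: "y \<in> A" "v = \<Psi> x y"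
    using v(1) by (rule imageE)
  obtain y' where y': "y' \<in> A'" "v = \<Psi> x' y'"
    using v(2) by (rule imageE)
  have "[item_val f x y i = item_val f x' y' i] (mod int p)" if "i \<in> I" for i
    using fun_cong[OF trans[OF y(2)[symmetric] y'(2)], of i] that by (simp add: \<Psi>_def cong_def)
  then show "\<exists>y\<in>A. \<exists>y'\<in>A'. \<forall>i\<in>I. [item_val f x y i = item_val f x' y' i] (mod int p)"
    using y(1) y'(1) by blast
qed

section \<open>Trading one item of a biased combination\<close>

lemma structured_mono: "structured k s c \<Longrightarrow> c \<le> c' \<Longrightarrow> structured k s c'"
  unfolding structured_def by (meson le_trans)

text \<open>Take for \<open>S\<close> a largest face occurring in the combination: all other faces miss a direction of
  \<open>S\<close>, so their terms can play the role of the bounded functions in the Gowers-Cauchy-Schwarz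
  inequality.\<close>

lemma biased_top_part:
  fixes \<alpha> :: "item \<Rightarrow> nat"
  assumes p: "prime p" and f: "periodic p n f" and I: "finite I" "\<And>i. i \<in> I \<Longrightarrow> valid k i"
    and \<alpha>: "\<alpha> \<in> I \<rightarrow>\<^sub>E {..<p}" "\<exists>i\<in>I. \<alpha> i \<noteq> 0"
    and bias: "1 / real p ^ r
      \<le> norm (mean (cubes p n k) (\<lambda>y. add_char p (\<Sum>i\<in>I. int (\<alpha> i) * item_val f x y i)))"
  shows "\<exists>J S G. S \<noteq> {} \<and> S \<subseteq> {..<k} \<and> J \<noteq> {} \<and> J \<subseteq> {ws. (ws, S) \<in> I \<and> \<alpha> (ws, S) \<noteq> 0} \<and>
    G = (\<lambda>x. \<Sum>ws\<in>J. int (\<alpha> (ws, S)) * fdiffs ws f x) \<and>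
    1 / real p ^ (r * 2 ^ k)
      \<le> norm (mean (S \<rightarrow>\<^sub>E vecs p n) (\<lambda>h. mean (vecs p n) (\<lambda>x. add_char p (cube_form S G x h))))"
proof -
  let ?B = "vecs p n"
  have p0: "p > 0"
    using p by (simp add: prime_gt_0_nat)
  have B: "finite ?B" "?B \<noteq> {}"
    using p0 by auto
  define supp where "supp = {i \<in> I. \<alpha> i \<noteq> 0}"
  have supp: "finite supp" "supp \<noteq> {}" "supp \<subseteq> I"
    using I(1) \<alpha>(2) by (auto simp: supp_def)
  obtain i1 where i1: "i1 \<in> supp" "\<And>i. i \<in> supp \<Longrightarrow> card (snd i) \<le> card (snd i1)"
    using obtains_MAX[OF supp(1,2), of "\<lambda>i. card (snd i)"] Max_ge[of "(\<lambda>i. card (snd i)) ` supp"] supp(1)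
    by (metis finite_imageI imageI)
  define S where "S = snd i1"
  define J where "J = {ws. (ws, S) \<in> supp}"
  define R where "R = {i \<in> supp. snd i \<noteq> S}"
  define G where "G x = (\<Sum>ws\<in>J. int (\<alpha> (ws, S)) * fdiffs ws f x)" for x
  have S: "S \<noteq> {}" "S \<subseteq> {..<k}" "finite S"
    using I(2)[of i1] i1(1) supp(3) finite_subset by (auto simp: valid_def S_def)
  have Jim: "(\<lambda>ws. (ws, S)) ` J \<union> R = supp" "(\<lambda>ws. (ws, S)) ` J \<inter> R = {}"
    by (auto simp: J_def R_def)
  have J: "finite J" "J \<noteq> {}"
  proof -
    have "finite ((\<lambda>ws. (ws, S)) ` J)"
      using Jim(1) supp(1) by (metis finite_Un)
    then show "finite J"
      by (rule finite_imageD) (simp add: inj_on_def)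
    show "J \<noteq> {}"
      using i1(1) unfolding J_def S_def by (metis empty_Collect_eq prod.collapse)
  qed
  have R: "finite R" "R \<subseteq> I"
    using supp by (auto simp: R_def)
  have split: "(\<Sum>i\<in>I. int (\<alpha> i) * item_val f x y i) = G (x + sum y S) + (\<Sum>i\<in>R. int (\<alpha> i) * item_val f x y i)" for y
  proof -
    have "(\<Sum>i\<in>I. int (\<alpha> i) * item_val f x y i) = (\<Sum>i\<in>supp. int (\<alpha> i) * item_val f x y i)"
      using I(1) by (intro sum.mono_neutral_right) (auto simp: supp_def)
    also have "\<dots> = (\<Sum>i\<in>(\<lambda>ws. (ws, S)) ` J. int (\<alpha> i) * item_val f x y i) + (\<Sum>i\<in>R. int (\<alpha> i) * item_val f x y i)"
      unfolding Jim(1)[symmetric] using J(1) R(1) Jim(2) by (intro sum.union_disjoint) auto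
    also have "(\<Sum>i\<in>(\<lambda>ws. (ws, S)) ` J. int (\<alpha> i) * item_val f x y i) = G (x + sum y S)"
      by (subst sum.reindex) (auto simp: inj_on_def G_def item_val_def)
    finally show ?thesis .
  qed
  have "\<exists>l. l \<in> S \<and> l \<notin> snd i" if "i \<in> R" for i
  proof (rule ccontr)
    assume "\<not> ?thesis"
    then have "S \<subseteq> snd i"
      by blast
    moreover have "card (snd i) \<le> card S" "snd i \<noteq> S"
      using that i1(2) by (auto simp: R_def S_def)
    moreover have "finite (snd i)"
      using I(2)[of i] that R(2) by (auto simp: valid_def intro: finite_subset)
    ultimately show False
      using card_seteq by blast
  qed
  then obtain miss where miss: "\<And>i. i \<in> R \<Longrightarrow> miss i \<in> S" "\<And>i. i \<in> R \<Longrightarrow> miss i \<notin> snd i"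
    by metis
  let ?C = "{..<k} - S"
  have CS: "?C \<union> S = {..<k}" "S \<inter> ?C = {}"
    using S by auto
  let ?F = "\<lambda>y. add_char p (\<Sum>i\<in>I. int (\<alpha> i) * item_val f x y i)"
  obtain w where w: "norm (mean ({..<k} \<rightarrow>\<^sub>E ?B) ?F)
      \<le> norm (mean (S \<rightarrow>\<^sub>E ?B) (\<lambda>y. ?F (\<lambda>i. if i \<in> ?C then w i else y i)))"
    using norm_mean_PiE_attained[of ?C ?B S ?F] B CS by auto
  define ext where "ext y = (\<lambda>i. if i \<in> ?C then w i else y i)" for y :: "nat \<Rightarrow> nat \<Rightarrow> int"
  \<comment> \<open>The terms on the other faces, grouped by a direction of \<open>S\<close> that
    they miss; thus \<open>b l\<close> does not depend on \<open>y l\<close>.\<close>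
  define b where "b l y = (\<Prod>i\<in>{i \<in> R. miss i = l}. add_char p (int (\<alpha> i) * item_val f x (ext y) i))" for l y
  have F: "?F (ext y) = add_char p (G (x + (\<Sum>i\<in>S. y i))) * (\<Prod>l\<in>S. b l y)" for y
  proof -
    have "(\<Prod>l\<in>S. b l y) = (\<Prod>i\<in>R. add_char p (int (\<alpha> i) * item_val f x (ext y) i))"
      unfolding b_def using R(1) S(3) miss(1) by (intro prod.group) auto
    moreover have "sum (ext y) S = (\<Sum>i\<in>S. y i)"
      by (intro sum.cong) (auto simp: ext_def)
    ultimately show ?thesis
      unfolding split add_char_add by (simp add: add_char_sum)
  qed
  have perG: "periodic p n G"
    unfolding G_def[abs_def]
  proof (rule periodic_sum)
    fix ws
    show "periodic p n (\<lambda>x. int (\<alpha> (ws, S)) * fdiffs ws f x)"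
      using periodic_comp[OF periodic_fdiffs[OF f], of "\<lambda>t. int (\<alpha> (ws, S)) * t"] .
  qed
  have gcs: "norm (mean (S \<rightarrow>\<^sub>E ?B) (\<lambda>y. add_char p (G (x + (\<Sum>i\<in>S. y i))) * (\<Prod>i\<in>S. b i y))) ^ 2 ^ card S
      \<le> Re (mean (S \<rightarrow>\<^sub>E ?B) (\<lambda>h. mean ?B (\<lambda>x. add_char p (cube_form S G x h))))"
  proof (rule gowers_cauchy_schwarz[OF p0 S(3,1) perG])
    show "norm (b i y) \<le> 1" for i y
      by (simp add: b_def prod_norm[symmetric])
    show "b l (y(l := v)) = b l y" if "l \<in> S" for l y v
      unfolding b_def
    proof (rule prod.cong[OF refl])
      fix i assume "i \<in> {i \<in> R. miss i = l}"
      then have "l \<notin> snd i"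
        using miss(2)[of i] by blast
      then have "sum (ext (y(l := v))) (snd i) = sum (ext y) (snd i)"
        by (intro sum.cong) (auto simp: ext_def)
      then show "add_char p (int (\<alpha> i) * item_val f x (ext (y(l := v))) i)
          = add_char p (int (\<alpha> i) * item_val f x (ext y) i)"
        by (simp add: item_val_def)
    qed
  qed
  \<comment> \<open>The inequality costs a power \<open>2 ^ card S\<close>; passing to
    \<open>2 ^ k\<close> gives a bound that does not depend on the face found.\<close>
  have "1 / real p ^ (r * 2 ^ k) = (1 / real p ^ r) ^ 2 ^ k"
    by (simp add: power_divide power_mult)
  also have "\<dots> \<le> (1 / real p ^ r) ^ 2 ^ card S"
  proof (rule power_decreasing)
    show "(2::nat) ^ card S \<le> 2 ^ k"
      using card_mono[OF _ S(2)] by (intro power_increasing) auto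
  qed (use p0 in auto)
  also have "\<dots> \<le> norm (mean (S \<rightarrow>\<^sub>E ?B) (\<lambda>y. add_char p (G (x + (\<Sum>i\<in>S. y i))) * (\<Prod>i\<in>S. b i y))) ^ 2 ^ card S"
    using bias w unfolding cubes_def ext_def[symmetric] F by (intro power_mono) auto
  also note gcs
  also have "Re (mean (S \<rightarrow>\<^sub>E ?B) (\<lambda>h. mean ?B (\<lambda>x. add_char p (cube_form S G x h))))
      \<le> norm (mean (S \<rightarrow>\<^sub>E ?B) (\<lambda>h. mean ?B (\<lambda>x. add_char p (cube_form S G x h))))"
    by (rule complex_Re_le_cmod)
  finally show ?thesis
    using S J by (intro exI[of _ J] exI[of _ S] exI[of _ G]) (auto simp: J_def supp_def G_def fun_eq_iff)
qed

text \<open>The induction on the degree fixes the cube form of the top part by derivatives at the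
  vertices. Its value at the top vertex then follows from the lower faces, and \<open>i0\<close>
  from the remaining items on the same face. \<open>New\<close> records what is needed at vertices
  other than the base point, \<open>H\<close> what is needed at the base point.\<close>

lemma overlap_step:
  assumes p: "prime p" and f: "periodic p n f" "deg_less p k f"
    and I: "finite I" "\<And>i. i \<in> I \<Longrightarrow> valid k i"
    and \<alpha>: "\<alpha> \<in> I \<rightarrow>\<^sub>E {..<p}" "\<exists>i\<in>I. \<alpha> i \<noteq> 0"
    and bias: "1 / real p ^ r
      \<le> norm (mean (cubes p n k) (\<lambda>y. add_char p (\<Sum>i\<in>I. int (\<alpha> i) * item_val f x0 y i)))"
    and struct: "\<And>j. j < k \<Longrightarrow> structured j (r * 2 ^ k) c"
  shows "\<exists>i0\<in>I. \<exists>New H. finite New \<and> card New \<le> card I * 2 ^ k * (c + 1) \<and>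
    (\<forall>i\<in>New. valid k i \<and> rank k i < rank k i0) \<and>
    finite H \<and> card H \<le> card I * 2 ^ k * (c + 1) \<and>
    (\<forall>x x'. (\<forall>h\<in>H. [fdiff h f x = fdiff h f x'] (mod int p)) \<longrightarrow>
      overlap p n k f (I - {i0} \<union> New) x x' \<longrightarrow> overlap p n k f I x x')"
proof -
  obtain J S G where S: "S \<noteq> {}" "S \<subseteq> {..<k}"
    and J: "J \<noteq> {}" "J \<subseteq> {ws. (ws, S) \<in> I \<and> \<alpha> (ws, S) \<noteq> 0}"
    and G: "G = (\<lambda>x. \<Sum>ws\<in>J. int (\<alpha> (ws, S)) * fdiffs ws f x)"
    and cube_bias: "1 / real p ^ (r * 2 ^ k)
      \<le> norm (mean (S \<rightarrow>\<^sub>E vecs p n) (\<lambda>h. mean (vecs p n) (\<lambda>x. add_char p (cube_form S G x h))))"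
    using biased_top_part[OF p f(1) I \<alpha> bias] by blast
  have finS: "finite S"
    using S(2) finite_subset by blast
  have JI: "(\<lambda>ws. (ws, S)) ` J \<subseteq> I"
    using J(2) by auto
  have finJ: "finite J"
    by (rule finite_imageD[OF finite_subset[OF JI I(1)]]) (simp add: inj_on_def)
  have cardJ: "card J \<le> card I"
    using card_mono[OF I(1) JI] by (simp add: card_image inj_on_def)
  have len: "ws \<noteq> []" "length ws \<le> k" if "ws \<in> J" for ws
    using I(2)[of "(ws, S)"] J(2) that by (auto simp: valid_def)
  obtain ws0 where ws0: "ws0 \<in> J" "\<And>ws. ws \<in> J \<Longrightarrow> length ws0 \<le> length ws"
    using ex_min_if_finite[of "length ` J"] finJ J(1)
    by (metis (no_types, lifting) arg_min_if_finite(1) arg_min_least)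
  define j where "j = k - length ws0"
  have "length ws0 > 0"
    using len(1)[OF ws0(1)] by simp
  then have jk: "j < k"
    using len(2)[OF ws0(1)] unfolding j_def by linarith
  have degs: "deg_less p (k - length ws) (fdiffs ws f)" for ws
    by (rule deg_less_fdiffs[OF f(2)])
  have degG: "deg_less p j G"
    unfolding G
  proof (rule deg_less_sum)
    fix ws assume "ws \<in> J"
    then show "deg_less p j (fdiffs ws f)"
      using ws0(2) by (intro deg_less_mono[OF _ degs]) (simp add: j_def diff_le_mono2)
  qed
  have perG: "periodic p n G"
    unfolding G
  proof (rule periodic_sum)
    fix ws
    show "periodic p n (\<lambda>x. int (\<alpha> (ws, S)) * fdiffs ws f x)"
      using periodic_comp[OF periodic_fdiffs[OF f(1)], of "\<lambda>t. int (\<alpha> (ws, S)) * t"] .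
  qed
  obtain W :: "(nat set \<Rightarrow> nat \<Rightarrow> int) set" where W: "finite W" "card W \<le> c"
    and W_det: "\<And>x h x' h'. \<forall>\<delta>\<in>W. \<forall>T\<subseteq>S. [fdiff (\<delta> T) G (x + sum h T) = fdiff (\<delta> T) G (x' + sum h' T)] (mod int p)
      \<Longrightarrow> [cube_form S G x h = cube_form S G x' h'] (mod int p)"
    using cube_form_determined[OF struct[OF jk] p perG degG S(2) cube_bias] by blast
  \<comment> \<open>\<open>New1\<close> has the items of \<open>J\<close> on proper nonempty faces;
    \<open>New2\<close> has them after one further difference, on all nonempty faces including
    \<open>S\<close>. The empty face is left to \<open>H\<close>.\<close>
  define New1 where "New1 = J \<times> (Pow S - {S, {}})"
  define New2 where "New2 = (\<lambda>(\<delta>, ws, T). (\<delta> T # ws, T)) ` (W \<times> {ws \<in> J. length ws < k} \<times> (Pow S - {{}}))"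
  define H where "H = (\<Union>ws\<in>J. partial_sums ws) \<union>
    (\<Union>(\<delta>, ws)\<in>W \<times> {ws \<in> J. length ws < k}. partial_sums (\<delta> {} # ws))"
  have cardPow: "card (Pow S) \<le> 2 ^ k"
    using card_mono[OF _ S(2)] finS by (simp add: card_Pow)
  have finNew: "finite (New1 \<union> New2)" and finH: "finite H"
    using finJ finS W(1) by (auto simp: New1_def New2_def H_def finite_partial_sums)
  have cardNew: "card (New1 \<union> New2) \<le> card I * 2 ^ k * (c + 1)"
  proof -
    have "card New1 \<le> card J * card (Pow S)"
      unfolding New1_def card_cartesian_product using finS finJ by (intro mult_le_mono card_mono) auto
    also have "\<dots> \<le> card I * 2 ^ k"
      by (intro mult_le_mono cardJ cardPow)
    finally have 1: "card New1 \<le> card I * 2 ^ k" .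
    have "card New2 \<le> card (W \<times> {ws \<in> J. length ws < k} \<times> (Pow S - {{}}))"
      unfolding New2_def using W(1) finJ finS by (intro card_image_le) auto
    also have "\<dots> \<le> card W * (card J * card (Pow S))"
      unfolding card_cartesian_product using W(1) finJ finS by (intro mult_le_mono card_mono) auto
    also have "\<dots> \<le> c * (card I * 2 ^ k)"
      by (intro mult_le_mono W(2) cardJ cardPow)
    finally have "card New1 + card New2 \<le> card I * 2 ^ k * (c + 1)"
      using 1 by (simp add: algebra_simps)
    then show ?thesis
      using card_Un_le le_trans by blast
  qed
  have cardH: "card H \<le> card I * 2 ^ k * (c + 1)"
  proof -
    have ps: "card (partial_sums ws) \<le> 2 ^ k" if "length ws \<le> k" for ws :: "(nat \<Rightarrow> int) list"
      using card_partial_sums[of ws] power_increasing[OF that, of "2 :: nat"] by linarith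
    have "card (\<Union>ws\<in>J. partial_sums ws) \<le> (\<Sum>ws\<in>J. card (partial_sums ws))"
      by (rule card_UN_le[OF finJ])
    also have "\<dots> \<le> (\<Sum>ws\<in>J. 2 ^ k)"
      by (intro sum_mono ps len)
    also have "\<dots> \<le> card I * 2 ^ k"
      using cardJ by simp
    finally have 1: "card (\<Union>ws\<in>J. partial_sums ws) \<le> card I * 2 ^ k" .
    let ?K = "W \<times> {ws \<in> J. length ws < k}"
    have "card (\<Union>(\<delta>, ws)\<in>?K. partial_sums (\<delta> {} # ws)) \<le> (\<Sum>(\<delta>, ws)\<in>?K. card (partial_sums (\<delta> {} # ws)))"
      using W(1) finJ card_UN_le[of ?K "\<lambda>(\<delta>, ws). partial_sums (\<delta> {} # ws)"] by (simp add: case_prod_unfold)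
    also have "\<dots> \<le> (\<Sum>(\<delta>, ws)\<in>?K. 2 ^ k)"
      by (intro sum_mono) (auto intro!: ps simp del: partial_sums.simps)
    also have "\<dots> = card W * card {ws \<in> J. length ws < k} * 2 ^ k"
      by (simp add: case_prod_unfold card_cartesian_product)
    also have "\<dots> \<le> c * card I * 2 ^ k"
      using finJ by (intro mult_le_mono W(2) le_trans[OF _ cardJ] card_mono) auto
    finally have "card (\<Union>ws\<in>J. partial_sums ws) + card (\<Union>(\<delta>, ws)\<in>?K. partial_sums (\<delta> {} # ws))
        \<le> card I * 2 ^ k * (c + 1)"
      using 1 by (simp add: algebra_simps)
    then show ?thesis
      unfolding H_def using card_Un_le le_trans by blast
  qed
  have new: "valid k i \<and> rank k i < rank k (ws0, S)" if "i \<in> New1 \<union> New2" for i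
    using that
  proof
    assume "i \<in> New1"
    then obtain ws T where i: "i = (ws, T)" "ws \<in> J" "T \<subset> S" "T \<noteq> {}"
      by (auto simp: New1_def)
    have "(k - length ws) * (k + 1) \<le> (k - length ws0) * (k + 1)"
      using ws0(2)[OF i(2)] by (intro mult_le_mono1 diff_le_mono2)
    moreover have "card T < card S"
      using i(3) finS by (rule psubset_card_mono[rotated])
    ultimately show ?thesis
      using i len[OF i(2)] S(2) by (auto simp: valid_def rank_def)
  next
    assume "i \<in> New2"
    then obtain \<delta> ws T where i: "i = (\<delta> T # ws, T)" "ws \<in> J" "length ws < k" "T \<subseteq> S" "T \<noteq> {}"
      by (auto simp: New2_def)
    have "card T \<le> k"
      using card_mono[of "{..<k}" T] i(4) S(2) by auto
    \<comment> \<open>One further difference lowers the rank by \<open>k + 1\<close>, which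
      outweighs a face of at most \<open>k\<close> directions even when \<open>T\<close> is all of
      \<open>S\<close>.\<close>
    have "(k - Suc (length ws)) * (k + 1) + card T < Suc (k - Suc (length ws)) * (k + 1)"
      using \<open>card T \<le> k\<close> by simp
    also have "\<dots> \<le> (k - length ws0) * (k + 1)"
      using ws0(2)[OF i(2)] i(3) by (intro mult_le_mono1) simp
    finally show ?thesis
      using i S(2) by (auto simp: valid_def rank_def)
  qed
  have transfer: "overlap p n k f I x x'"
    if agree: "\<forall>h\<in>H. [fdiff h f x = fdiff h f x'] (mod int p)"
      and ov: "overlap p n k f (I - {(ws0, S)} \<union> (New1 \<union> New2)) x x'" for x x'
    unfolding overlap_def
  proof (intro allI impI)
    let ?Y = "cubes p n k"
    fix A A' assume A: "A \<subseteq> ?Y" "A' \<subseteq> ?Y" "3 * card ?Y \<le> 4 * card A" "3 * card ?Y \<le> 4 * card A'"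
    obtain y y' where y: "y \<in> A" "y' \<in> A'"
      and eqs: "\<forall>i\<in>I - {(ws0, S)} \<union> (New1 \<union> New2). [item_val f x y i = item_val f x' y' i] (mod int p)"
      using overlapD[OF ov A] by (elim bexE)
    have eq: "[item_val f x y i = item_val f x' y' i] (mod int p)"
      if "i \<in> I - {(ws0, S)} \<union> (New1 \<union> New2)" for i
      by (rule bspec[OF eqs that])
    have base: "[fdiffs ws f x = fdiffs ws f x'] (mod int p)" if "ws \<noteq> []" "partial_sums ws \<subseteq> H" for ws
      using that agree by (intro fdiffs_determined) auto
    have lower: "[fdiffs ws f (x + sum y T) = fdiffs ws f (x' + sum y' T)] (mod int p)"
      if "ws \<in> J" "T \<subset> S" for ws T
    proof (cases "T = {}")
      case True
      then show ?thesis
        using base[of ws] that len[of ws] by (auto simp: H_def)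
    next
      case False
      then have "(ws, T) \<in> New1"
        using that by (auto simp: New1_def)
      then show ?thesis
        using eq[of "(ws, T)"] by (simp add: item_val_def)
    qed
    have derived: "[fdiffs (\<delta> T # ws) f (x + sum y T) = fdiffs (\<delta> T # ws) f (x' + sum y' T)] (mod int p)"
      if "\<delta> \<in> W" "ws \<in> J" "T \<subseteq> S" for \<delta> ws T
    proof (cases "length ws < k")
      case False
      \<comment> \<open>Once \<open>k\<close> differences have been taken, a further one is
        congruent to zero, so both sides agree without an item.\<close>
      then have "deg_less p 0 (fdiffs (\<delta> T # ws) f)"
        using degs[of "\<delta> T # ws"] by simp
      then show ?thesis
        unfolding deg_less.simps using cong_sym cong_trans by blast
    next
      case True
      show ?thesis
      proof (cases "T = {}")
        case True
        have "partial_sums (\<delta> {} # ws) \<subseteq> H"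
          using that \<open>length ws < k\<close> unfolding H_def by blast
        then show ?thesis
          using base[of "\<delta> {} # ws"] True by simp
      next
        case False
        then have "(\<delta> T # ws, T) \<in> New2"
          using that \<open>length ws < k\<close> unfolding New2_def by force
        then show ?thesis
          using eq[of "(\<delta> T # ws, T)"] by (simp add: item_val_def)
      qed
    qed
    have "[fdiff (\<delta> T) G (x + sum y T) = fdiff (\<delta> T) G (x' + sum y' T)] (mod int p)"
      if "\<delta> \<in> W" "T \<subseteq> S" for \<delta> T
      unfolding G fdiff_sum using derived[OF that(1) _ that(2)] by (intro cong_sum cong_scalar_left) simp
    then have form: "[cube_form S G x y = cube_form S G x' y'] (mod int p)"
      by (intro W_det) blast
    have lowerG: "[(\<Sum>T\<in>Pow S - {S}. (- 1) ^ card (S - T) * G (x + sum y T))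
        = (\<Sum>T\<in>Pow S - {S}. (- 1) ^ card (S - T) * G (x' + sum y' T))] (mod int p)"
      unfolding G by (intro cong_sum cong_scalar_left lower) auto
    \<comment> \<open>The top vertex has coefficient 1 in the cube form, so it is found by
      subtracting the other vertices.\<close>
    have "[G (x + sum y S) = G (x' + sum y' S)] (mod int p)"
      using cong_diff[OF form lowerG] unfolding cube_form_split_top[OF finS] by simp
    moreover have "[(\<Sum>ws\<in>J - {ws0}. int (\<alpha> (ws, S)) * fdiffs ws f (x + sum y S))
        = (\<Sum>ws\<in>J - {ws0}. int (\<alpha> (ws, S)) * fdiffs ws f (x' + sum y' S))] (mod int p)"
    proof (intro cong_sum cong_scalar_left)
      fix ws assume "ws \<in> J - {ws0}"
      then show "[fdiffs ws f (x + sum y S) = fdiffs ws f (x' + sum y' S)] (mod int p)"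
        using eq[of "(ws, S)"] J(2) by (auto simp: item_val_def)
    qed
    ultimately have "[int (\<alpha> (ws0, S)) * fdiffs ws0 f (x + sum y S)
        = int (\<alpha> (ws0, S)) * fdiffs ws0 f (x' + sum y' S)] (mod int p)"
      using cong_diff unfolding G sum.remove[OF finJ ws0(1)] by fastforce
    moreover have "coprime (int (\<alpha> (ws0, S))) (int p)"
    proof -
      have "\<alpha> (ws0, S) < p" "\<alpha> (ws0, S) \<noteq> 0"
        using ws0(1) J(2) \<alpha>(1) by auto
      then show ?thesis
        using coprime_diff_residues[OF p, of 0 "\<alpha> (ws0, S)"] by simp
    qed
    ultimately have "[item_val f x y (ws0, S) = item_val f x' y' (ws0, S)] (mod int p)"
      by (simp add: item_val_def cong_mult_lcancel)
    then show "\<exists>y\<in>A. \<exists>y'\<in>A'. \<forall>i\<in>I. [item_val f x y i = item_val f x' y' i] (mod int p)"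
      using y eq by blast
  qed
  have "(ws0, S) \<in> I"
    using ws0(1) J(2) by auto
  then show ?thesis
    using finNew cardNew new finH cardH transfer
    by (intro bexI[of _ "(ws0, S)"] exI[of _ "New1 \<union> New2"] exI[of _ H]) blast+
qed

section \<open>Termination of the trade, with bounds uniform in the field and the dimension\<close>

lemma ranks_subseteq:
  assumes "finite I" "card I \<le> L" "\<And>i. i \<in> I \<Longrightarrow> rank k i < \<rho>"
  shows "image_mset (rank k) (mset_set I) \<subseteq># repeat_mset L (mset_set {..<\<rho>})"
proof (rule mset_subset_eqI)
  fix t
  show "count (image_mset (rank k) (mset_set I)) t \<le> count (repeat_mset L (mset_set {..<\<rho>})) t"
  proof (cases "t < \<rho>")
    case True
    have "count (image_mset (rank k) (mset_set I)) t \<le> size (image_mset (rank k) (mset_set I))"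
      by (rule count_le_size)
    also have "\<dots> \<le> L"
      using assms(2) by simp
    finally show ?thesis
      using True by simp
  next
    case False
    then have "t \<notin># image_mset (rank k) (mset_set I)"
      using assms(1,3) by auto
    then have "count (image_mset (rank k) (mset_set I)) t = 0"
      by (rule not_in_iff[THEN iffD1])
    then show ?thesis
      by (simp only: le0)
  qed
qed

lemma structured_uniform:
  assumes "\<And>j. j < k \<Longrightarrow> \<exists>c. structured j s c"
  shows "\<exists>c. \<forall>j<k. structured j s c"
proof -
  obtain c where c: "\<And>j. j < k \<Longrightarrow> structured j s (c j)"
    using assms by metis
  have "c j \<le> (\<Sum>j<k. c j)" if "j < k" for j
    using that by (intro member_le_sum) auto
  then show ?thesis
    using c structured_mono by blast
qed

text \<open>The induction runs over the envelope \<open>v\<close> of the ranks and not over the item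
  set, because \<open>N\<close> must be chosen before the prime, the dimension, the function and the
  items are known.\<close>

definition overlap_bounded :: "nat \<Rightarrow> nat multiset \<Rightarrow> nat \<Rightarrow> bool" where
  "overlap_bounded k v N \<longleftrightarrow> (\<forall>p n f I. prime p \<longrightarrow> periodic p n f \<longrightarrow> deg_less p k f \<longrightarrow>
     finite I \<longrightarrow> (\<forall>i\<in>I. valid k i) \<longrightarrow> image_mset (rank k) (mset_set I) \<subseteq># v \<longrightarrow>
     (\<exists>H. finite H \<and> card H \<le> N \<and> (\<forall>x x'. (\<forall>h\<in>H. [fdiff h f x = fdiff h f x'] (mod int p)) \<longrightarrow>
       overlap p n k f I x x')))"

lemma overlap_boundedD:
  assumes "overlap_bounded k v N" "prime p" "periodic p n f" "deg_less p k f" "finite I"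
    "\<forall>i\<in>I. valid k i" "image_mset (rank k) (mset_set I) \<subseteq># v"
  shows "\<exists>H. finite H \<and> card H \<le> N \<and> (\<forall>x x'. (\<forall>h\<in>H. [fdiff h f x = fdiff h f x'] (mod int p)) \<longrightarrow>
    overlap p n k f I x x')"
  using assms unfolding overlap_bounded_def by simp

text \<open>Trading items terminates because the multiset of ranks decreases; the multiset also bounds the
  number of directions collected on the way.\<close>

lemma overlap_bounded_exists:
  assumes IH: "\<And>j s. j < k \<Longrightarrow> \<exists>c. structured j s c"
  shows "\<exists>N. overlap_bounded k v N"
proof (induction v rule: wf_induct_rule[OF wf_mult1[OF wf_less_than]])
  case (1 v)
  \<comment> \<open>\<open>card I\<close> is at most \<open>size v\<close>, so this exponent,
    depending on \<open>v\<close> alone, covers the threshold \<open>card I + 2\<close> of the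
    counting argument.\<close>
  define r where "r = size v + 2"
  obtain c where c: "\<And>j. j < k \<Longrightarrow> structured j (r * 2 ^ k) c"
    using structured_uniform[OF IH] by blast
  define L where "L = size v * 2 ^ k * (c + 1)"
  define nxt where "nxt \<rho> = v - {#\<rho>#} + repeat_mset L (mset_set {..<\<rho>})" for \<rho>
  have "\<exists>N. overlap_bounded k (nxt \<rho>) N" if "\<rho> \<in># v" for \<rho>
  proof (rule 1)
    have "v = add_mset \<rho> (v - {#\<rho>#})"
      using that by simp
    moreover have "\<forall>b. b \<in># repeat_mset L (mset_set {..<\<rho>}) \<longrightarrow> (b, \<rho>) \<in> less_than"
      by (auto simp: count_greater_zero_iff[symmetric] count_mset_set'
          simp del: count_greater_zero_iff split: if_splits)
    ultimately show "(nxt \<rho>, v) \<in> mult1 less_than"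
      unfolding mult1_def nxt_def by blast
  qed
  then obtain N where N: "\<And>\<rho>. \<rho> \<in># v \<Longrightarrow> overlap_bounded k (nxt \<rho>) (N \<rho>)"
    by metis
  show ?case
    unfolding overlap_bounded_def
  \<comment> \<open>\<open>L\<close> pays for the directions of one trade. The sum allows for every
    rank in \<open>v\<close>, as the rank that is traded depends on \<open>p\<close>,
    \<open>n\<close>, \<open>f\<close> and \<open>I\<close>.\<close>
  proof (intro exI[of _ "L + (\<Sum>\<rho>\<in>set_mset v. N \<rho>)"] allI impI)
    fix p n f I
    assume p: "prime p" and f: "periodic p n f" "deg_less p k f"
      and I: "finite I" "\<forall>i\<in>I. valid k i" and sub: "image_mset (rank k) (mset_set I) \<subseteq># v"
    have p0: "p > 0"
      using p by (simp add: prime_gt_0_nat)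
    have cardI: "card I \<le> size v"
      using size_mset_mono[OF sub] by simp
    show "\<exists>H. finite H \<and> card H \<le> L + (\<Sum>\<rho>\<in>set_mset v. N \<rho>) \<and>
      (\<forall>x x'. (\<forall>h\<in>H. [fdiff h f x = fdiff h f x'] (mod int p)) \<longrightarrow> overlap p n k f I x x')"
    proof (cases "\<forall>x \<alpha>. \<alpha> \<in> I \<rightarrow>\<^sub>E {..<p} \<longrightarrow> (\<exists>i\<in>I. \<alpha> i \<noteq> 0) \<longrightarrow>
        norm (mean (cubes p n k) (\<lambda>y. add_char p (\<Sum>i\<in>I. int (\<alpha> i) * item_val f x y i)))
        \<le> 1 / real p ^ (card I + 2)")
      case True
      then have "overlap p n k f I x x'" for x x'
        by (intro overlap_if_equidistributed[OF p I(1)]) blast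
      then show ?thesis
        by (intro exI[of _ "{}"]) simp
    next
      case False
      \<comment> \<open>The point \<open>x0\<close> serves only to detect the bias; the trade
        derived from it is valid for all \<open>x\<close> and \<open>x'\<close>.\<close>
      then obtain x0 \<alpha> where \<alpha>: "\<alpha> \<in> I \<rightarrow>\<^sub>E {..<p}" "\<exists>i\<in>I. \<alpha> i \<noteq> 0"
        and large: "1 / real p ^ (card I + 2)
          < norm (mean (cubes p n k) (\<lambda>y. add_char p (\<Sum>i\<in>I. int (\<alpha> i) * item_val f x0 y i)))"
        unfolding not_le[symmetric] by blast
      have "1 / real p ^ r \<le> 1 / real p ^ (card I + 2)"
        using p0 cardI by (intro divide_left_mono power_increasing) (auto simp: r_def)
      then have "1 / real p ^ r
          \<le> norm (mean (cubes p n k) (\<lambda>y. add_char p (\<Sum>i\<in>I. int (\<alpha> i) * item_val f x0 y i)))"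
        using large by linarith
      from overlap_step[OF p f I(1) _ \<alpha> this c] I(2)
      obtain i0 New H where i0: "i0 \<in> I" and New: "finite New" "card New \<le> card I * 2 ^ k * (c + 1)"
          "\<forall>i\<in>New. valid k i \<and> rank k i < rank k i0"
        and H: "finite H" "card H \<le> card I * 2 ^ k * (c + 1)"
        and trade: "\<And>x x'. \<forall>h\<in>H. [fdiff h f x = fdiff h f x'] (mod int p) \<Longrightarrow>
          overlap p n k f (I - {i0} \<union> New) x x' \<Longrightarrow> overlap p n k f I x x'"
        by blast
      have leL: "card I * 2 ^ k * (c + 1) \<le> L"
        unfolding L_def by (intro mult_le_mono cardI) auto
      have split: "mset_set I = add_mset i0 (mset_set (I - {i0}))"
        by (rule mset_set.remove[OF I(1) i0])
      have rank0: "rank k i0 \<in># v" "image_mset (rank k) (mset_set (I - {i0})) \<subseteq># v - {#rank k i0#}"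
        using sub unfolding split image_mset_add_mset insert_subset_eq_iff by auto
      have "mset_set (I - {i0} \<union> New) \<subseteq># mset_set (I - {i0}) + mset_set New"
        using I(1) New(1) by (intro mset_subset_eqI) (auto simp: count_mset_set')
      then have "image_mset (rank k) (mset_set (I - {i0} \<union> New))
          \<subseteq># image_mset (rank k) (mset_set (I - {i0})) + image_mset (rank k) (mset_set New)"
        using image_mset_subseteq_mono by fastforce
      also have "\<dots> \<subseteq># nxt (rank k i0)"
        unfolding nxt_def using New leL
        by (intro subset_mset.add_mono rank0(2) ranks_subseteq) auto
      finally have sub': "image_mset (rank k) (mset_set (I - {i0} \<union> New)) \<subseteq># nxt (rank k i0)" .
      have fin': "finite (I - {i0} \<union> New)"
        using I(1) New(1) by simp
      have valid': "\<forall>i\<in>I - {i0} \<union> New. valid k i"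
        using I(2) New(3) by blast
      obtain H' where H': "finite H'" "card H' \<le> N (rank k i0)"
        and ov: "\<forall>x x'. (\<forall>h\<in>H'. [fdiff h f x = fdiff h f x'] (mod int p)) \<longrightarrow>
          overlap p n k f (I - {i0} \<union> New) x x'"
        using overlap_boundedD[OF N[OF rank0(1)] p f fin' valid' sub'] by (elim exE conjE)
      have "N (rank k i0) \<le> (\<Sum>\<rho>\<in>set_mset v. N \<rho>)"
        using rank0(1) by (intro member_le_sum) auto
      then have "card (H \<union> H') \<le> L + (\<Sum>\<rho>\<in>set_mset v. N \<rho>)"
        using card_Un_le[of H H'] H(2) H'(2) leL by linarith
      then show ?thesis
        using H(1) H'(1) trade[OF _ ov[rule_format]] by (intro exI[of _ "H \<union> H'"]) auto
    qed
  qed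
qed

section \<open>Cubes with good vertices, and the induction on the degree\<close>

lemma mean_cube_vertex:
  assumes p: "p > 0" and F: "periodic p n F" and S: "S \<noteq> {}" "S \<subseteq> {..<k}"
  shows "mean (cubes p n k) (\<lambda>y. F (x + sum y S)) = mean (vecs p n) F"
proof -
  let ?B = "vecs p n"
  obtain a where a: "a \<in> S" "a < k"
    using S by auto
  define C where "C = {..<k} - {a}"
  have C: "{..<k} = insert a C" "a \<notin> C" "finite C"
    using a(2) by (auto simp: C_def)
  have sum: "sum (y(a := v)) S = v + sum y (S - {a})" for y :: "nat \<Rightarrow> nat \<Rightarrow> int" and v
  proof -
    have "sum (y(a := v)) S = (y(a := v)) a + sum (y(a := v)) (S - {a})"
      using a S(2) finite_subset by (intro sum.remove) auto
    also have "sum (y(a := v)) (S - {a}) = sum y (S - {a})"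
      by (intro sum.cong) auto
    finally show ?thesis
      by (simp only: fun_upd_same)
  qed
  have "mean (cubes p n k) (\<lambda>y. F (x + sum y S))
      = mean ?B (\<lambda>v. mean (C \<rightarrow>\<^sub>E ?B) (\<lambda>y. F (v + (x + sum y (S - {a})))))"
    unfolding cubes_def C(1) mean_PiE_insert[OF C(2)] sum by (simp only: add.left_commute)
  also have "\<dots> = mean (C \<rightarrow>\<^sub>E ?B) (\<lambda>y. mean ?B (\<lambda>v. F (v + (x + sum y (S - {a})))))"
    by (rule mean_swap)
  also have "\<dots> = mean (C \<rightarrow>\<^sub>E ?B) (\<lambda>y. mean ?B F)"
    by (simp only: mean_shift[OF p F])
  also have "\<dots> = mean ?B F"
    using p C(3) by (intro mean_const) (auto simp: finite_PiE PiE_eq_empty_iff)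
  finally show ?thesis .
qed

text \<open>Each of the fewer than \<open>2 ^ k\<close> vertices other than the base point is
  uniformly distributed, hence bad for at most a fraction \<open>1 / 2 ^ (k + 2)\<close> of the
  cubes. A union bound loses at most a quarter of them.\<close>

lemma card_good_cubes:
  assumes p: "p > 0" and Good: "periodic p n Good"
    and bad: "real (card {x \<in> vecs p n. \<not> Good x}) \<le> card (vecs p n) / 2 ^ (k + 2)"
  shows "3 * card (cubes p n k) \<le> 4 * card {y \<in> cubes p n k. \<forall>S\<in>Pow {..<k} - {{}}. Good (x + sum y S)}"
proof -
  let ?Y = "cubes p n k" and ?P = "Pow {..<k} - {{}} :: nat set set"
  let ?A = "{y \<in> ?Y. \<forall>S\<in>?P. Good (x + sum y S)}"
  let ?F = "\<lambda>x. if Good x then 0 else 1 :: real"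
  have Y: "finite ?Y" "?Y \<noteq> {}"
    using cubes_finite_nonempty[OF p, of n k] by blast+
  have each: "real (card {y \<in> ?Y. \<not> Good (x + sum y S)}) \<le> card ?Y / 2 ^ (k + 2)" if "S \<in> ?P" for S
  proof -
    have "mean ?Y (\<lambda>y. ?F (x + sum y S)) = mean (vecs p n) ?F"
      using that by (intro mean_cube_vertex[OF p periodic_comp[OF Good]]) auto
    also have "\<dots> = real (card {x \<in> vecs p n. \<not> Good x}) / card (vecs p n)"
      by (simp add: mean_def sum.If_cases Int_def)
    also have "\<dots> \<le> 1 / 2 ^ (k + 2)"
      using bad card_vecs_pos[OF p, of n] by (simp add: field_simps)
    finally have "mean ?Y (\<lambda>y. ?F (x + sum y S)) \<le> 1 / 2 ^ (k + 2)" .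
    moreover have "mean ?Y (\<lambda>y. ?F (x + sum y S)) = real (card {y \<in> ?Y. \<not> Good (x + sum y S)}) / card ?Y"
      using Y(1) by (simp add: mean_def sum.If_cases Int_def)
    moreover have "real (card ?Y) > 0"
      using Y by (simp add: card_gt_0_iff)
    ultimately show ?thesis
      by (simp add: field_simps)
  qed
  have "?Y - ?A \<subseteq> (\<Union>S\<in>?P. {y \<in> ?Y. \<not> Good (x + sum y S)})"
    by auto
  then have "card (?Y - ?A) \<le> card (\<Union>S\<in>?P. {y \<in> ?Y. \<not> Good (x + sum y S)})"
    using Y(1) by (intro card_mono) auto
  also have "\<dots> \<le> (\<Sum>S\<in>?P. card {y \<in> ?Y. \<not> Good (x + sum y S)})"
    by (intro card_UN_le) simp
  finally have "real (card (?Y - ?A)) \<le> (\<Sum>S\<in>?P. real (card {y \<in> ?Y. \<not> Good (x + sum y S)}))"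
    using of_nat_mono by fastforce
  also have "\<dots> \<le> (\<Sum>S\<in>?P. card ?Y / 2 ^ (k + 2))"
    by (intro sum_mono each)
  also have "\<dots> \<le> 2 ^ k * (card ?Y / 2 ^ (k + 2))"
  proof -
    have "card ?P \<le> card (Pow {..<k})"
      by (intro card_mono) auto
    then have "card ?P \<le> 2 ^ k"
      by (simp add: card_Pow)
    then have "real (card ?P) \<le> 2 ^ k"
      by (metis of_nat_le_iff of_nat_numeral of_nat_power)
    then show ?thesis
      unfolding sum_constant by (intro mult_right_mono) auto
  qed
  also have "\<dots> = card ?Y / 4"
    by (simp add: power_add)
  finally have "4 * card (?Y - ?A) \<le> card ?Y"
    by linarith
  moreover have "card (?Y - ?A) = card ?Y - card ?A" "card ?A \<le> card ?Y"
    using Y(1) by (auto intro!: card_Diff_subset card_mono)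
  ultimately show ?thesis
    by linarith
qed

text \<open>Strong induction with \<open>s\<close> arbitrary, since the trades call for lower
  degrees with bias exponents that grow with the number of items.\<close>

theorem bias_implies_structure: "\<exists>c. structured k s c"
proof (induction k arbitrary: s rule: less_induct)
  case (less k)
  show ?case
  proof (cases "k = 0")
    case True
    have trivial: "determined_by p f {}" if "deg_less p 0 f" for p and f :: "(nat \<Rightarrow> int) \<Rightarrow> int"
      using that unfolding determined_by_def deg_less.simps using cong_sym cong_trans by blast
    have "structured k s 0"
      unfolding structured_def
    proof (intro allI impI)
      fix p n and f :: "(nat \<Rightarrow> int) \<Rightarrow> int" assume "deg_less p k f"
      then show "\<exists>H. finite H \<and> card H \<le> 0 \<and> determined_by p f H"
        using trivial True by (intro exI[of _ "{}"]) simp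
    qed
    then show ?thesis ..
  next
    case False
    \<comment> \<open>\<open>M\<close> bounds the number of sampling directions times the number of
      vertices; \<open>\<rho>\<close> exceeds the rank of every valid item.\<close>
    define M where "M = k ^ (2 * s + 2 + (k + 2)) * 2 ^ k"
    define \<rho> where "\<rho> = k * (k + 1) + k + 1"
    let ?P = "Pow {..<k} - {{}} :: nat set set"
    obtain N where N: "overlap_bounded k (repeat_mset M (mset_set {..<\<rho>})) N"
      using overlap_bounded_exists[OF less.IH] by blast
    have "structured k s N"
      unfolding structured_def
    proof (intro allI impI)
      fix p n and f :: "(nat \<Rightarrow> int) \<Rightarrow> int"
      assume p: "prime p" and f: "periodic p n f" "deg_less p k f"
        and bias: "1 / real p ^ s \<le> norm (mean (vecs p n) (\<lambda>x. add_char p (f x)))"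
      have p0: "p > 0"
        using p by (simp add: prime_gt_0_nat)
      obtain H0 Good where H0: "finite H0" "card H0 \<le> k ^ (2 * s + 2 + (k + 2))"
        and Good: "periodic p n Good" "real (card {x \<in> vecs p n. \<not> Good x}) \<le> card (vecs p n) / 2 ^ (k + 2)"
        and det: "\<And>x x'. Good x \<Longrightarrow> Good x' \<Longrightarrow> \<forall>h\<in>H0. [fdiff h f x = fdiff h f x'] (mod int p)
          \<Longrightarrow> [f x = f x'] (mod int p)"
        using biased_determined_mostly[OF p f bias, of "k + 2"] by blast
      \<comment> \<open>Each item asks for agreement of one sampling derivative at one vertex other
        than the base point.\<close>
      define I where "I = (\<lambda>(h, S). ([h], S)) ` (H0 \<times> ?P)"
      have finI: "finite I"
        using H0(1) by (simp add: I_def)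
      have cardI: "card I \<le> M"
      proof -
        have "card I \<le> card (H0 \<times> ?P)"
          unfolding I_def using H0(1) by (intro card_image_le) simp
        also have "\<dots> \<le> k ^ (2 * s + 2 + (k + 2)) * card (Pow {..<k})"
          unfolding card_cartesian_product by (intro mult_le_mono H0(2) card_mono) auto
        finally show ?thesis
          by (simp add: M_def card_Pow)
      qed
      have validI: "\<forall>i\<in>I. valid k i"
        using False by (auto simp: I_def valid_def)
      have rank_less: "rank k i < \<rho>" if "i \<in> I" for i
      proof -
        have "card (snd i) \<le> k"
          using validI that card_mono[of "{..<k}" "snd i"] by (auto simp: valid_def)
        moreover have "(k - length (fst i)) * (k + 1) \<le> k * (k + 1)"
          by (intro mult_le_mono1) simp
        ultimately show ?thesis
          unfolding rank_def \<rho>_def by linarith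
      qed
      have rankI: "image_mset (rank k) (mset_set I) \<subseteq># repeat_mset M (mset_set {..<\<rho>})"
        by (rule ranks_subseteq[OF finI cardI rank_less])
      obtain H where H: "finite H" "card H \<le> N"
        and ov: "\<forall>x x'. (\<forall>h\<in>H. [fdiff h f x = fdiff h f x'] (mod int p)) \<longrightarrow> overlap p n k f I x x'"
        using overlap_boundedD[OF N p f finI validI rankI] by (elim exE conjE)
      have "determined_by p f H"
        unfolding determined_by_def
      proof (intro allI impI)
        fix x x' assume agree: "\<forall>h\<in>H. [fdiff h f x = fdiff h f x'] (mod int p)"
        let ?A = "\<lambda>x. {y \<in> cubes p n k. \<forall>S\<in>?P. Good (x + sum y S)}"
        have "overlap p n k f I x x'"
          using ov agree by blast
        then have "\<exists>y\<in>?A x. \<exists>y'\<in>?A x'. \<forall>i\<in>I. [item_val f x y i = item_val f x' y' i] (mod int p)"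
          by (rule overlapD[OF _ _ _ card_good_cubes[OF p0 Good] card_good_cubes[OF p0 Good]]) auto
        then obtain y y' where y: "y \<in> ?A x" "y' \<in> ?A x'"
          and eq: "\<forall>i\<in>I. [item_val f x y i = item_val f x' y' i] (mod int p)"
          by (elim bexE)
        have vertex: "[f (x + sum y S) = f (x' + sum y' S)] (mod int p)" if "S \<in> ?P" for S
        proof (rule det)
          show "Good (x + sum y S)" "Good (x' + sum y' S)"
            using y that by auto
          show "\<forall>h\<in>H0. [fdiff h f (x + sum y S) = fdiff h f (x' + sum y' S)] (mod int p)"
          proof
            fix h assume "h \<in> H0"
            then have "([h], S) \<in> I"
              using that by (force simp: I_def)
            then show "[fdiff h f (x + sum y S) = fdiff h f (x' + sum y' S)] (mod int p)"
              using eq by (auto simp: item_val_def)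
          qed
        qed
        let ?R = "\<lambda>x y. \<Sum>T\<in>Pow {..<k} - {{}}. (- 1) ^ card ({..<k} - T) * f (x + sum y T)"
        \<comment> \<open>The cube has \<open>k\<close> directions and \<open>f\<close> has degree
          less than \<open>k\<close>, so the alternating sum vanishes. The sign of the base point is
          its own inverse and is cancelled by multiplying with it once more.\<close>
        have zero: "[(- 1) ^ k * f x + ?R x y = 0] (mod int p)" for x y
          using cube_form_vanish[of "{..<k}" p f x y] f(2) cube_form_split_bottom[of "{..<k}" f x y] by simp
        have "[?R x y = ?R x' y'] (mod int p)"
          by (intro cong_sum cong_scalar_left vertex)
        with cong_trans[OF zero cong_sym[OF zero]]
        have "[((- 1) ^ k * f x + ?R x y) - ?R x y = ((- 1) ^ k * f x' + ?R x' y') - ?R x' y'] (mod int p)"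
          by (rule cong_diff)
        then have "[(- 1) ^ k * ((- 1) ^ k * f x) = (- 1) ^ k * ((- 1) ^ k * f x')] (mod int p)"
          by (intro cong_scalar_left[where b = "(- 1) ^ k * f x"]) simp
        moreover have "(- 1) ^ k * ((- 1) ^ k * t) = t" for t :: int
          by (simp add: mult.assoc[symmetric] power_mult_distrib[symmetric])
        ultimately show "[f x = f x'] (mod int p)"
          by (simp only:)
      qed
      then show "\<exists>H. finite H \<and> card H \<le> N \<and> determined_by p f H"
        using H by blast
    qed
    then show ?thesis
      by blast
  qed
qed

section \<open>Derivatives of polynomials\<close>

text \<open>Polynomial functions over the integers: degrees are counted without any reduction, and
  the coefficients are reduced modulo \<open>p\<close> only once, in
  \<open>derivative_in_polys\<close>.\<close>

definition poly_funs :: "nat \<Rightarrow> int \<Rightarrow> ((nat \<Rightarrow> int) \<Rightarrow> int) set" where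
  "poly_funs n d = {F. \<exists>a. \<forall>x. F x = (\<Sum>\<alpha>\<in>exponents n d. a \<alpha> * (\<Prod>i<n. x i ^ \<alpha> i))}"

lemma poly_funs_zero: "(\<lambda>_. 0) \<in> poly_funs n d"
  unfolding poly_funs_def by (auto intro!: exI[of _ "\<lambda>_. 0"])

lemma poly_funs_add:
  assumes "F \<in> poly_funs n d" "G \<in> poly_funs n d"
  shows "(\<lambda>x. F x + G x) \<in> poly_funs n d"
proof -
  obtain a b where "\<And>x. F x = (\<Sum>\<alpha>\<in>exponents n d. a \<alpha> * (\<Prod>i<n. x i ^ \<alpha> i))"
    "\<And>x. G x = (\<Sum>\<alpha>\<in>exponents n d. b \<alpha> * (\<Prod>i<n. x i ^ \<alpha> i))"
    using assms unfolding poly_funs_def by auto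
  then show ?thesis
    unfolding poly_funs_def by (auto intro!: exI[of _ "\<lambda>\<alpha>. a \<alpha> + b \<alpha>"] simp: distrib_right sum.distrib)
qed

lemma poly_funs_scale:
  assumes "F \<in> poly_funs n d"
  shows "(\<lambda>x. c * F x) \<in> poly_funs n d"
proof -
  obtain a where "\<And>x. F x = (\<Sum>\<alpha>\<in>exponents n d. a \<alpha> * (\<Prod>i<n. x i ^ \<alpha> i))"
    using assms unfolding poly_funs_def by auto
  then show ?thesis
    unfolding poly_funs_def by (auto intro!: exI[of _ "\<lambda>\<alpha>. c * a \<alpha>"] simp: sum_distrib_left mult.assoc)
qed

lemma poly_funs_sum:
  "(\<And>j. j \<in> J \<Longrightarrow> F j \<in> poly_funs n d) \<Longrightarrow> (\<lambda>x. \<Sum>j\<in>J. F j x) \<in> poly_funs n d"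
  by (induction J rule: infinite_finite_induct) (simp_all add: poly_funs_zero poly_funs_add)

lemma poly_funs_monomial:
  assumes "\<alpha> \<in> exponents n d"
  shows "(\<lambda>x. \<Prod>i<n. x i ^ \<alpha> i) \<in> poly_funs n d"
proof -
  have eq: "(\<Sum>\<beta>\<in>exponents n d. (if \<beta> = \<alpha> then 1 else 0) * (\<Prod>i<n. x i ^ \<beta> i)) = (\<Prod>i<n. x i ^ \<alpha> i)"
    for x :: "nat \<Rightarrow> int"
    using assms by (subst sum.remove[OF finite_exponents assms]) (auto intro!: sum.neutral)
  show ?thesis
    unfolding poly_funs_def by (rule CollectI, rule exI, rule allI, rule eq[symmetric])
qed

lemma poly_funs_mono:
  assumes "F \<in> poly_funs n d" "d \<le> d'"
  shows "F \<in> poly_funs n d'"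
proof -
  obtain a where a: "\<And>x. F x = (\<Sum>\<alpha>\<in>exponents n d. a \<alpha> * (\<Prod>i<n. x i ^ \<alpha> i))"
    using assms(1) unfolding poly_funs_def by auto
  have "(\<lambda>x. \<Sum>\<alpha>\<in>exponents n d. a \<alpha> * (\<Prod>i<n. x i ^ \<alpha> i)) \<in> poly_funs n d'"
    using assms(2) by (intro poly_funs_sum poly_funs_scale poly_funs_monomial) (auto simp: exponents_def)
  then show ?thesis
    unfolding a[symmetric] .
qed

lemma poly_funs_times_var:
  assumes "F \<in> poly_funs n d" "j < n"
  shows "(\<lambda>x. x j * F x) \<in> poly_funs n (d + 1)"
proof -
  obtain a where a: "\<And>x. F x = (\<Sum>\<alpha>\<in>exponents n d. a \<alpha> * (\<Prod>i<n. x i ^ \<alpha> i))"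
    using assms(1) unfolding poly_funs_def by auto
  let ?u = "\<lambda>\<alpha>. \<alpha>(j := Suc (\<alpha> j))"
  have j: "j \<in> {..<n}"
    using assms(2) by simp
  have mono: "x j * (\<Prod>i<n. x i ^ \<alpha> i) = (\<Prod>i<n. x i ^ ?u \<alpha> i)" for \<alpha> :: "nat \<Rightarrow> nat" and x :: "nat \<Rightarrow> int"
  proof -
    have "(\<Prod>i\<in>{..<n} - {j}. x i ^ ?u \<alpha> i) = (\<Prod>i\<in>{..<n} - {j}. x i ^ \<alpha> i)"
      by (intro prod.cong) auto
    then show ?thesis
      unfolding prod.remove[OF finite_lessThan j] by simp
  qed
  have exps: "?u \<alpha> \<in> exponents n (d + 1)" if "\<alpha> \<in> exponents n d" for \<alpha>
  proof -
    have "(\<Sum>i\<in>{..<n} - {j}. ?u \<alpha> i) = (\<Sum>i\<in>{..<n} - {j}. \<alpha> i)"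
      by (intro sum.cong) auto
    then have "(\<Sum>i<n. ?u \<alpha> i) = Suc (\<Sum>i<n. \<alpha> i)"
      unfolding sum.remove[OF finite_lessThan j] by simp
    then have "int (\<Sum>i<n. ?u \<alpha> i) = int (\<Sum>i<n. \<alpha> i) + 1"
      by (simp only: of_nat_Suc add.commute)
    moreover have "\<alpha> \<in> {..<n} \<rightarrow>\<^sub>E UNIV" "int (\<Sum>i<n. \<alpha> i) \<le> d"
      using that by (simp_all add: exponents_def)
    moreover from this(1) have "?u \<alpha> \<in> {..<n} \<rightarrow>\<^sub>E UNIV"
      using j by (auto simp: PiE_iff extensional_def)
    ultimately show ?thesis
      unfolding exponents_def mem_Collect_eq by linarith
  qed
  have "(\<lambda>x. \<Sum>\<alpha>\<in>exponents n d. a \<alpha> * (\<Prod>i<n. x i ^ ?u \<alpha> i)) \<in> poly_funs n (d + 1)"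
    by (intro poly_funs_sum poly_funs_scale poly_funs_monomial exps)
  then show ?thesis
    unfolding a sum_distrib_left mono[symmetric] by (simp add: mult.left_commute)
qed

text \<open>\<open>Q'\<close> stands for \<open>Q\<close> with shifted variables. With P and D the
  two functions of the conclusion, the next difference is x_j D + c D + c P: the terms of degree r +
  a + 1 have cancelled. Both bounds are proved together because P enters this recursion.\<close>

lemma shifted_power_diff:
  assumes "j < n" "Q \<in> poly_funs n r" "(\<lambda>x. Q' x - Q x) \<in> poly_funs n (r - 1)"
  shows "(\<lambda>x. x j ^ a * Q x) \<in> poly_funs n (r + int a) \<and>
    (\<lambda>x. (x j + c) ^ a * Q' x - x j ^ a * Q x) \<in> poly_funs n (r + int a - 1)"
proof (induction a)
  case 0
  then show ?case
    using assms by simp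
next
  case (Suc a)
  let ?P = "\<lambda>x. x j ^ a * Q x" and ?D = "\<lambda>x. (x j + c) ^ a * Q' x - x j ^ a * Q x"
  have "(\<lambda>x. x j * ?P x) \<in> poly_funs n (r + int (Suc a))"
    using poly_funs_times_var[OF conjunct1[OF Suc] assms(1)] by (simp add: algebra_simps)
  moreover have "(\<lambda>x. x j * ?D x + (c * ?D x + c * ?P x)) \<in> poly_funs n (r + int a)"
  proof (intro poly_funs_add poly_funs_scale)
    show "(\<lambda>x. x j * ?D x) \<in> poly_funs n (r + int a)"
      using poly_funs_times_var[OF conjunct2[OF Suc] assms(1)] by simp
    show "?D \<in> poly_funs n (r + int a)" "?P \<in> poly_funs n (r + int a)"
      using Suc poly_funs_mono[of ?D n "r + int a - 1" "r + int a"] by auto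
  qed
  ultimately show ?case
    by (simp add: algebra_simps)
qed

lemma shifted_monomial_diff:
  assumes "m \<le> n"
  shows "(\<lambda>x. \<Prod>i<m. x i ^ \<alpha> i) \<in> poly_funs n (int (\<Sum>i<m. \<alpha> i)) \<and>
    (\<lambda>x. (\<Prod>i<m. (x i + h i) ^ \<alpha> i) - (\<Prod>i<m. x i ^ \<alpha> i)) \<in> poly_funs n (int (\<Sum>i<m. \<alpha> i) - 1)"
  using assms
proof (induction m)
  case 0
  \<comment> \<open>The constant 1 is the monomial of the extensional zero exponent vector. The
    accompanying difference is 0, in accordance with the degree bound -1.\<close>
  have "(\<lambda>x. \<Prod>i<n. x i ^ (\<lambda>i\<in>{..<n}. 0) i) \<in> poly_funs n 0"
    by (rule poly_funs_monomial) (auto simp: exponents_def PiE_iff extensional_def)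
  then show ?case
    by (simp add: poly_funs_zero)
next
  case (Suc m)
  have "(\<lambda>x. x m ^ \<alpha> m * (\<Prod>i<m. x i ^ \<alpha> i)) \<in> poly_funs n (int (\<Sum>i<m. \<alpha> i) + int (\<alpha> m)) \<and>
    (\<lambda>x. (x m + h m) ^ \<alpha> m * (\<Prod>i<m. (x i + h i) ^ \<alpha> i) - x m ^ \<alpha> m * (\<Prod>i<m. x i ^ \<alpha> i))
      \<in> poly_funs n (int (\<Sum>i<m. \<alpha> i) + int (\<alpha> m) - 1)"
    using Suc by (intro shifted_power_diff) auto
  then show ?case
    by (simp add: mult.commute)
qed

lemma derivative_in_polys:
  assumes p: "p > 0" and f: "f \<in> polys p n d"
  shows "derivative p n h f \<in> polys p n (d - 1)"
proof -
  obtain a where a: "\<And>x. x \<in> vecs p n \<Longrightarrow>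
      f x = (\<Sum>\<alpha>\<in>exponents n d. a \<alpha> * (\<Prod>i<n. x i ^ \<alpha> i)) mod int p"
    using f unfolding polys_def by auto
  let ?R = "\<lambda>x. \<Sum>\<alpha>\<in>exponents n d. a \<alpha> * ((\<Prod>i<n. (x i + h i) ^ \<alpha> i) - (\<Prod>i<n. x i ^ \<alpha> i))"
  have "?R \<in> poly_funs n (d - 1)"
  proof (intro poly_funs_sum poly_funs_scale)
    fix \<alpha> assume "\<alpha> \<in> exponents n d"
    then have "int (\<Sum>i<n. \<alpha> i) - 1 \<le> d - 1"
      by (simp add: exponents_def)
    then show "(\<lambda>x. (\<Prod>i<n. (x i + h i) ^ \<alpha> i) - (\<Prod>i<n. x i ^ \<alpha> i)) \<in> poly_funs n (d - 1)"
      using shifted_monomial_diff[of n n \<alpha> h] poly_funs_mono by blast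
  qed
  then obtain b where b: "\<And>x. ?R x = (\<Sum>\<alpha>\<in>exponents n (d - 1). b \<alpha> * (\<Prod>i<n. x i ^ \<alpha> i))"
    unfolding poly_funs_def by auto
  have eq: "derivative p n h f x = (\<Sum>\<alpha>\<in>exponents n (d - 1). (b \<alpha> mod int p) * (\<Prod>i<n. x i ^ \<alpha> i)) mod int p"
    if x: "x \<in> vecs p n" for x
  proof -
    have vadd: "vadd p n x h \<in> vecs p n"
      using p by (simp add: vadd_def vecs_def Fp_def)
    have "[(\<Prod>i<n. vadd p n x h i ^ \<alpha> i) = (\<Prod>i<n. (x i + h i) ^ \<alpha> i)] (mod int p)" for \<alpha>
      by (intro cong_prod cong_pow) (simp add: vadd_def cong_def)
    then have "[(\<Sum>\<alpha>\<in>exponents n d. a \<alpha> * (\<Prod>i<n. vadd p n x h i ^ \<alpha> i))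
        = (\<Sum>\<alpha>\<in>exponents n d. a \<alpha> * (\<Prod>i<n. (x i + h i) ^ \<alpha> i))] (mod int p)"
      by (intro cong_sum cong_scalar_left)
    then have "[f (vadd p n x h) = (\<Sum>\<alpha>\<in>exponents n d. a \<alpha> * (\<Prod>i<n. (x i + h i) ^ \<alpha> i))] (mod int p)"
      using a[OF vadd] by (simp add: cong_def)
    moreover have "[f x = (\<Sum>\<alpha>\<in>exponents n d. a \<alpha> * (\<Prod>i<n. x i ^ \<alpha> i))] (mod int p)"
      using a[OF x] by (simp add: cong_def)
    ultimately have "[f (vadd p n x h) - f x = ?R x] (mod int p)"
      unfolding right_diff_distrib sum_subtractf by (rule cong_diff)
    also have "[?R x = (\<Sum>\<alpha>\<in>exponents n (d - 1). (b \<alpha> mod int p) * (\<Prod>i<n. x i ^ \<alpha> i))] (mod int p)"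
      unfolding b by (intro cong_sum cong_scalar_right) (simp add: cong_def)
    finally show ?thesis
      using x by (simp add: derivative_def cong_def)
  qed
  have coeffs: "(\<lambda>\<alpha>. b \<alpha> mod int p) \<in> exponents n (d - 1) \<rightarrow> Fp p"
    using p by (simp add: Fp_def)
  have range: "derivative p n h f \<in> vecs p n \<rightarrow>\<^sub>E Fp p"
    using p by (simp add: derivative_def Fp_def)
  show ?thesis
    unfolding polys_def
    by (rule CollectI, rule conjI[OF range], rule bexI[OF _ coeffs], rule ballI, rule eq)
qed

section \<open>From polynomials on \<open>vecs p n\<close> to periodic functions and back\<close>

lemma derivative_eq_fdiff:
  assumes "p > 0"
  shows "derivative p n (reduce p n h) f (reduce p n x) = fdiff h (\<lambda>x. f (reduce p n x)) x mod int p"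
proof -
  have "vadd p n (reduce p n x) (reduce p n h) = reduce p n (x + h)"
    by (auto simp: vadd_def reduce_def mod_add_eq fun_eq_iff)
  then show ?thesis
    using reduce_in_vecs[OF assms] by (simp add: derivative_def fdiff_def)
qed

text \<open>Degree bound -1 leaves no exponents, which is the base case. Each step passes to a
  derivative, which lowers the bound by one and agrees modulo \<open>p\<close> with the difference
  of the periodic extension.\<close>

lemma polys_deg_less:
  assumes p: "p > 0"
  shows "f \<in> polys p n (int k - 1) \<Longrightarrow> deg_less p k (\<lambda>x. f (reduce p n x))"
proof (induction k arbitrary: f)
  case 0
  obtain a where a: "\<And>x. x \<in> vecs p n \<Longrightarrow>
      f x = (\<Sum>\<alpha>\<in>exponents n (int 0 - 1). a \<alpha> * (\<Prod>i<n. x i ^ \<alpha> i)) mod int p"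
    using 0 unfolding polys_def by auto
  have "exponents n (int 0 - 1) = {}"
    unfolding exponents_def by (simp del: of_nat_sum)
  then have "f (reduce p n x) = 0" for x
    using a[OF reduce_in_vecs[OF p]] by simp
  then show ?case
    by simp
next
  case (Suc k)
  have "deg_less p k (fdiff h (\<lambda>x. f (reduce p n x)))" for h
  proof (rule deg_less_cong)
    show "deg_less p k (\<lambda>x. derivative p n (reduce p n h) f (reduce p n x))"
      using Suc.IH derivative_in_polys[OF p Suc.prems] by simp
    show "[derivative p n (reduce p n h) f (reduce p n x) = fdiff h (\<lambda>x. f (reduce p n x)) x] (mod int p)" for x
      by (simp add: derivative_eq_fdiff[OF p] cong_def)
  qed
  then show ?case
    by simp
qed

theorem theorem1p1:
  fixes d s :: nat
  shows "\<exists>c::nat. \<forall>(p::nat) (n::nat) f.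
    prime p \<longrightarrow> f \<in> polys p n (int d) \<longrightarrow>
    norm (expectation p n (\<lambda>x. add_char p (f x))) \<ge> real p powi (- int s) \<longrightarrow>
    (\<exists>(g :: nat \<Rightarrow> (nat \<Rightarrow> int) \<Rightarrow> int) (\<Gamma> :: (nat \<Rightarrow> int) \<Rightarrow> int).
       (\<forall>i<c. g i \<in> polys p n (int d - 1)) \<and>
       \<Gamma> \<in> vecs p c \<rightarrow> Fp p \<and>
       (\<forall>x\<in>vecs p n. f x = \<Gamma> (\<lambda>i\<in>{..<c}. g i x)) \<and>
       (\<forall>i<c. \<exists>h\<in>vecs p n. g i = derivative p n h f))"
proof -
  obtain c where c: "structured (Suc d) s c"
    using bias_implies_structure by blast
  show ?thesis
  proof (intro exI[of _ c] allI impI)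
    fix p n f
    assume p: "prime p" and f: "f \<in> polys p n (int d)"
      and bias: "norm (expectation p n (\<lambda>x. add_char p (f x))) \<ge> real p powi (- int s)"
    have p0: "p > 0"
      using p by (simp add: prime_gt_0_nat)
    \<comment> \<open>The periodic extension of \<open>f\<close>, on which differences in arbitrary
      integer directions make sense.\<close>
    define F where "F x = f (reduce p n x)" for x
    have F: "F x = f x" if "x \<in> vecs p n" for x
      using that by (simp add: F_def reduce_id)
    have "mean (vecs p n) (\<lambda>x. add_char p (F x)) = expectation p n (\<lambda>x. add_char p (f x))"
      by (simp add: mean_def expectation_def F cong: sum.cong)
    then have "1 / real p ^ s \<le> norm (mean (vecs p n) (\<lambda>x. add_char p (F x)))"
      using bias by (simp add: power_int_minus field_simps)
    moreover have "periodic p n F"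
      unfolding F_def[abs_def] by (rule periodic_reduce_comp)
    moreover have "deg_less p (Suc d) F"
      unfolding F_def[abs_def] using f by (intro polys_deg_less[OF p0]) simp
    ultimately obtain H where H: "finite H" "card H \<le> c" "determined_by p F H"
      using c p unfolding structured_def by blast
    obtain w where w: "bij_betw w {0..<card H} H"
      using ex_bij_betw_nat_finite[OF H(1)] by blast
    \<comment> \<open>\<open>w\<close> enumerates only \<open>card H\<close> directions. From index
      \<open>card H\<close> up to \<open>c - 1\<close> its value is arbitrary, but the reduced
      direction still gives a derivative of \<open>f\<close>; this pads the list to length exactly
      \<open>c\<close>.\<close>
    define g where "g i = derivative p n (reduce p n (w i)) f" for i
    define v where "v x = (\<lambda>i\<in>{..<c}. g i x)" for x
    \<comment> \<open>The value of \<open>f\<close> at some preimage; by \<open>det\<close> the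
      choice of the preimage is immaterial. Off the image of \<open>v\<close>, the value 0 keeps
      \<open>\<Gamma>\<close> inside \<open>Fp p\<close>.\<close>
    define \<Gamma> where "\<Gamma> t = (if t \<in> v ` vecs p n then f (inv_into (vecs p n) v t) else 0)" for t
    have fFp: "f x \<in> Fp p" if "x \<in> vecs p n" for x
      using f that by (auto simp: polys_def)
    have det: "f x = f x'" if x: "x \<in> vecs p n" "x' \<in> vecs p n" and eq: "v x = v x'" for x x'
    proof -
      have "[fdiff h F x = fdiff h F x'] (mod int p)" if "h \<in> H" for h
      proof -
        have "h \<in> w ` {0..<card H}"
          using w that by (simp add: bij_betw_def)
        then obtain i where "i < card H" and i: "h = w i"
          by auto
        then have "i < c"
          using H(2) by simp
        then have "g i x = g i x'"
          using fun_cong[OF eq, of i] \<open>i < c\<close> by (simp add: v_def)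
        moreover have "g i z = fdiff h F z mod int p" if "z \<in> vecs p n" for z
          using derivative_eq_fdiff[OF p0, of n h f z] that i
          by (simp add: g_def F_def[abs_def] reduce_id)
        ultimately show ?thesis
          using x by (simp add: cong_def)
      qed
      then have "[F x = F x'] (mod int p)"
        using H(3) unfolding determined_by_def by blast
      then show ?thesis
        using fFp[OF x(1)] fFp[OF x(2)] by (simp add: F x cong_def Fp_def)
    qed
    show "\<exists>g \<Gamma>. (\<forall>i<c. g i \<in> polys p n (int d - 1)) \<and> \<Gamma> \<in> vecs p c \<rightarrow> Fp p \<and>
       (\<forall>x\<in>vecs p n. f x = \<Gamma> (\<lambda>i\<in>{..<c}. g i x)) \<and>
       (\<forall>i<c. \<exists>h\<in>vecs p n. g i = derivative p n h f)"
    proof (intro exI[of _ g] exI[of _ \<Gamma>] conjI allI impI ballI)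
      show "g i \<in> polys p n (int d - 1)" for i
        unfolding g_def by (rule derivative_in_polys[OF p0 f])
      show "\<Gamma> \<in> vecs p c \<rightarrow> Fp p"
      proof
        fix t
        show "\<Gamma> t \<in> Fp p"
        proof (cases "t \<in> v ` vecs p n")
          case True
          then show ?thesis
            unfolding \<Gamma>_def if_P[OF True] by (intro fFp inv_into_into)
        next
          case False
          then show ?thesis
            using p0 by (simp add: \<Gamma>_def Fp_def)
        qed
      qed
      show "f x = \<Gamma> (\<lambda>i\<in>{..<c}. g i x)" if "x \<in> vecs p n" for x
      proof -
        have vx: "v x \<in> v ` vecs p n"
          using that by (rule imageI)
        show ?thesis
          unfolding v_def[symmetric] \<Gamma>_def if_P[OF vx]
          by (rule det[OF that inv_into_into[OF vx] f_inv_into_f[OF vx, symmetric]])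
      qed
      show "\<exists>h\<in>vecs p n. g i = derivative p n h f" for i
        unfolding g_def using reduce_in_vecs[OF p0] by blast
    qed
  qed
qed

end
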